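(* Let $1\le p<\infty$ and let $\nu$ be a modulus of variation with $\nu(k)\uparrow\infty$ and $\nu(k)/k^{1/p}$ nonincreasing with limit $0$. The following are equivalent: (i) the Fourier series of every continuous function in $V_p[\nu]$ converges uniformly; (ii) $\sum_{k=1}^\infty\nu(k)k^{-(1+1/p)}<\infty$; (iii) $\sum_{k=1}^\infty\Delta(k^{-1/p})\nu(k)<\infty$; (iv) $\sum_{k=1}^\infty\varepsilon_1(k)k^{-1/p}<\infty$; (v) $\sum_{k=1}^\infty\varepsilon_p(k)k^{-1}<\infty$.
   Context: A modulus of variation is a nondecreasing concave sequence of positive numbers $\nu(1),\nu(2),\dots$, with the convention $\nu(0)=0$. $\varepsilon_p(k)=(\nu(k)^p-\nu(k-1)^p)^{1/p}$ (so $\varepsilon_1(k)=\nu(k)-\nu(k-1)$), and $\Delta(\gamma_k)=\gamma_k-\gamma_{k+1}$. For $f$ and $n\ge1$, $\upsilon_p(n,f)=\sup(\sum_{j=1}^n|f(I_j)|^p)^{1/p}$ over $n$ nonoverlapping subintervals $I_j$ of $[0,2\pi]$, $f(I)=f(\sup I)-f(\inf I)$; $V_p[\nu]$ is the class of bounded $2\pi$-periodic $f$ with $\upsilon_p(n,f)\le C\nu(n)$ for all $n$ and some $C$. *)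

theory Defs
  imports "HOL-Analysis.Analysis"
begin

definition modulus_of_variation :: "(nat \<Rightarrow> real) \<Rightarrow> bool" where
  "modulus_of_variation \<nu> \<longleftrightarrow>
     \<nu> 0 = 0 \<and>
     (\<forall>k\<ge>1. \<nu> k > 0) \<and>
     (\<forall>k\<ge>1. \<nu> k \<le> \<nu> (Suc k)) \<and>
     (\<forall>k\<ge>2. \<nu> (Suc k) - \<nu> k \<le> \<nu> k - \<nu> (k - 1))"

definition eps_p :: "real \<Rightarrow> (nat \<Rightarrow> real) \<Rightarrow> nat \<Rightarrow> real" where
  "eps_p p \<nu> k = (\<nu> k powr p - \<nu> (k - 1) powr p) powr (1 / p)"

definition Delta :: "(nat \<Rightarrow> real) \<Rightarrow> nat \<Rightarrow> real" where
  "Delta \<gamma> k = \<gamma> k - \<gamma> (Suc k)"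

definition var_sums :: "real \<Rightarrow> nat \<Rightarrow> (real \<Rightarrow> real) \<Rightarrow> real set" where
  "var_sums p n f =
     {(\<Sum>j<n. \<bar>f (b j) - f (a j)\<bar> powr p) powr (1 / p) | a b.
        (\<forall>j<n. 0 \<le> a j \<and> a j \<le> b j \<and> b j \<le> 2 * pi) \<and>
        (\<forall>j. Suc j < n \<longrightarrow> b j \<le> a (Suc j))}"

definition upsilon_p :: "real \<Rightarrow> nat \<Rightarrow> (real \<Rightarrow> real) \<Rightarrow> real" where
  "upsilon_p p n f = Sup (var_sums p n f)"

definition periodic_2pi :: "(real \<Rightarrow> real) \<Rightarrow> bool" where
  "periodic_2pi f \<longleftrightarrow> (\<forall>x. f (x + 2 * pi) = f x)"

definition Vp :: "real \<Rightarrow> (nat \<Rightarrow> real) \<Rightarrow> (real \<Rightarrow> real) set" where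
  "Vp p \<nu> = {f. bounded (range f) \<and> periodic_2pi f \<and>
                (\<exists>C. \<forall>n\<ge>1. upsilon_p p n f \<le> C * \<nu> n)}"

definition fourier_cos :: "(real \<Rightarrow> real) \<Rightarrow> nat \<Rightarrow> real" where
  "fourier_cos f k = (1 / pi) * integral {0..2 * pi} (\<lambda>t. f t * cos (real k * t))"

definition fourier_sin :: "(real \<Rightarrow> real) \<Rightarrow> nat \<Rightarrow> real" where
  "fourier_sin f k = (1 / pi) * integral {0..2 * pi} (\<lambda>t. f t * sin (real k * t))"

definition fourier_partial_sum :: "(real \<Rightarrow> real) \<Rightarrow> nat \<Rightarrow> real \<Rightarrow> real" where
  "fourier_partial_sum f n x =
     fourier_cos f 0 / 2 +
     (\<Sum>k=1..n. fourier_cos f k * cos (real k * x) + fourier_sin f k * sin (real k * x))"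

end

theory Submission
  imports Defs
begin

text \<open>
  Conditions (ii)--(v) are compared termwise: \<open>eps_p p \<nu> k\<close> lies between
  \<open>k powr (1 - 1 / p) * eps_p 1 \<nu> k\<close> and \<open>\<nu> k / k powr (1 / p)\<close>, and (iii) and (iv) differ by a
  summation by parts whose boundary term tends to \<open>0\<close>.

  For (ii) \<open>\<Longrightarrow>\<close> (i), the power mean inequality turns the bound on \<open>upsilon_p p n f\<close> into
  one on sums of first powers. Split \<open>[0, pi]\<close> into blocks of length
  \<open>h = pi / (n + 1 / 2)\<close>, on which the Dirichlet kernel alternates in sign. Summation by parts bounds
  the Dirichlet integral of \<open>g\<close> by \<open>\<Sum>k. A k / k\<^sup>2\<close>, where \<open>A k\<close> is an alternating sum of \<open>k\<close> values of
  \<open>g\<close>; continuity controls \<open>A k\<close> for small \<open>k\<close>, and the variation controls it for large \<open>k\<close>.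

  For (i) \<open>\<Longrightarrow>\<close> (v), suppose that (v) fails and place on disjoint intervals, for each \<open>k\<close>, a bump of height
  \<open>eps_p p \<nu> k\<close> that is half a sine wave in resonance with the kernel \<open>dirichlet (N i)\<close>, where \<open>i\<close>
  is the stage of \<open>k\<close>. The stages are so long that their resonant contributions to the partial sums at
  \<open>0\<close> are unbounded, and the \<open>N i\<close> grow so fast that all other stages contribute a bounded amount.
\<close>

section \<open>Moduli of variation\<close>

lemma powr_diff_ge:
  fixes a b p :: real
  assumes "1 \<le> p" "0 \<le> b" "b \<le> a"
  shows "a powr (p - 1) * (a - b) \<le> a powr p - b powr p"
proof (cases "b = 0")
  case True
  then show ?thesis
    using assms by (cases "a = 0") (auto simp: powr_mult_base mult.commute[of _ a])
next
  case False
  then have ab: "a > 0" "b > 0" using assms by auto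
  have "b powr p = b * b powr (p - 1)" using ab by (simp add: powr_mult_base)
  also have "\<dots> \<le> b * a powr (p - 1)"
    using assms ab by (intro mult_left_mono powr_mono2) auto
  finally have "b powr p \<le> b * a powr (p - 1)" .
  moreover have "a powr p = a * a powr (p - 1)" using ab by (simp add: powr_mult_base)
  ultimately show ?thesis by (simp add: algebra_simps)
qed

locale modulus =
  fixes p :: real and \<nu> :: "nat \<Rightarrow> real"
  assumes p: "1 \<le> p"
    and mv: "modulus_of_variation \<nu>"
    and decr: "\<forall>k\<ge>1. \<nu> (Suc k) / real (Suc k) powr (1 / p) \<le> \<nu> k / real k powr (1 / p)"
    and lim0: "(\<lambda>k. \<nu> k / real k powr (1 / p)) \<longlonglongrightarrow> 0"
begin

lemma nu_0 [simp]: "\<nu> 0 = 0"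
  using mv by (simp add: modulus_of_variation_def)

lemma nu_pos: "k \<ge> 1 \<Longrightarrow> \<nu> k > 0"
  using mv by (simp add: modulus_of_variation_def)

lemma nu_nonneg [simp]: "\<nu> k \<ge> 0"
  using nu_pos[of k] by (cases k) auto

lemma nu_mono: "m \<le> n \<Longrightarrow> \<nu> m \<le> \<nu> n"
proof (induction rule: dec_induct)
  case (step n)
  have "\<nu> n \<le> \<nu> (Suc n)"
    using mv by (cases n) (auto simp: modulus_of_variation_def)
  with step show ?case by simp
qed simp

lemma ratio_antimono:
  assumes "1 \<le> m" "m \<le> n"
  shows "\<nu> n / real n powr (1 / p) \<le> \<nu> m / real m powr (1 / p)"
  using assms(2)
proof (induction rule: dec_induct)
  case (step n)
  then show ?case using decr assms(1) by (meson dual_order.trans)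
qed simp

text \<open>This is \<open>ratio_antimono\<close> raised to the power \<open>p\<close> and cleared
  of denominators: \<open>\<nu> n powr p / n\<close> is nonincreasing. Every later comparison of
  values of \<open>\<nu>\<close> at different indices rests on it.\<close>

lemma nu_powr_mult_le:
  assumes "1 \<le> m" "m \<le> n"
  shows "\<nu> n powr p * real m \<le> \<nu> m powr p * real n"
proof -
  have "(\<nu> n / real n powr (1 / p)) powr p \<le> (\<nu> m / real m powr (1 / p)) powr p"
    using p by (intro powr_mono2 ratio_antimono assms) auto
  then show ?thesis
    using p assms by (simp add: powr_divide powr_powr field_simps)
qed

lemma nu_pred_powr_ge: "\<nu> k powr p * (real k - 1) \<le> \<nu> (k - 1) powr p * real k"
proof (cases "k \<le> 1")
  case True
  then have "k = 0 \<or> k = 1" by auto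
  then show ?thesis by auto
next
  case False
  then show ?thesis using nu_powr_mult_le[of "k - 1" k] by (simp add: of_nat_diff)
qed

lemma eps_p_powr: "eps_p p \<nu> k powr p = \<nu> k powr p - \<nu> (k - 1) powr p"
proof -
  have "\<nu> (k - 1) powr p \<le> \<nu> k powr p"
    using p by (intro powr_mono2 nu_mono) auto
  then show ?thesis
    using p by (simp add: eps_p_def powr_powr)
qed

lemma eps_p_nonneg [simp]: "eps_p p \<nu> k \<ge> 0"
  by (simp add: eps_p_def)

lemma eps_1: "eps_p 1 \<nu> k = \<nu> k - \<nu> (k - 1)"
  by (simp add: eps_p_def nu_mono)

lemma sum_eps_p_powr: "(\<Sum>k=1..n. eps_p p \<nu> k powr p) = \<nu> n powr p"
  by (induction n) (auto simp: eps_p_powr)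

lemma eps_p_powr_le:
  assumes "k \<ge> 1"
  shows "eps_p p \<nu> k powr p \<le> \<nu> k powr p / real k"
  using nu_pred_powr_ge[of k] assms by (simp add: eps_p_powr field_simps)

lemma eps_p_le:
  assumes "k \<ge> 1"
  shows "eps_p p \<nu> k \<le> \<nu> k / real k powr (1 / p)"
proof -
  have "(eps_p p \<nu> k powr p) powr (1 / p) \<le> (\<nu> k powr p / real k) powr (1 / p)"
    using p by (intro powr_mono2 eps_p_powr_le assms) auto
  then show ?thesis
    using p by (simp add: powr_powr powr_divide)
qed

text \<open>Monotonicity of \<open>\<nu> k powr p / k\<close> gives
  \<open>\<nu> (k - 1) \<ge> \<nu> k * (1 - 1 / k) powr (1 / p)\<close>. The base lies in
  \<open>[0, 1]\<close> and \<open>1 / p \<le> 1\<close>, so the exponent may be replaced by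
  \<open>1\<close>.\<close>

lemma eps_1_le:
  assumes "k \<ge> 1"
  shows "eps_p 1 \<nu> k \<le> \<nu> k / real k"
proof -
  have "(\<nu> k powr p * (1 - 1 / real k)) powr (1 / p) \<le> (\<nu> (k - 1) powr p) powr (1 / p)"
  proof (intro powr_mono2)
    show "\<nu> k powr p * (1 - 1 / real k) \<le> \<nu> (k - 1) powr p"
      using assms nu_pred_powr_ge[of k] by (simp add: field_simps)
    show "0 \<le> \<nu> k powr p * (1 - 1 / real k)"
      using assms by (intro mult_nonneg_nonneg) auto
  qed (use p in auto)
  then have *: "\<nu> k * (1 - 1 / real k) powr (1 / p) \<le> \<nu> (k - 1)"
    using p assms by (simp add: powr_powr powr_mult)
  have "(1 - 1 / real k) powr 1 \<le> (1 - 1 / real k) powr (1 / p)"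
    using p assms by (intro powr_mono') auto
  then have "\<nu> k * (1 - 1 / real k) \<le> \<nu> k * (1 - 1 / real k) powr (1 / p)"
    using assms by (intro mult_left_mono) (auto split: if_splits)
  with * show ?thesis by (simp add: eps_1 algebra_simps)
qed

text \<open>By \<open>powr_diff_ge\<close> the \<open>p\<close>-th power of
  \<open>eps_p p \<nu> k\<close> is at least \<open>\<nu> k powr (p - 1) * eps_p 1 \<nu> k\<close>,
  and \<open>\<nu> k \<ge> k * eps_p 1 \<nu> k\<close> by \<open>eps_1_le\<close>. Together these
  give the factor \<open>k powr (p - 1)\<close>, whose \<open>p\<close>-th root appears in the
  claim.\<close>

lemma eps_1_le_eps_p:
  assumes "k \<ge> 1"
  shows "eps_p 1 \<nu> k * real k powr (1 - 1 / p) \<le> eps_p p \<nu> k"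
proof -
  let ?e = "eps_p 1 \<nu> k"
  have e: "?e \<ge> 0" by (simp add: eps_1 nu_mono)
  have "(?e * real k powr (1 - 1 / p)) powr p = ?e powr p * real k powr (p - 1)"
    using p by (simp add: powr_mult powr_powr algebra_simps)
  also have "\<dots> = (real k * ?e) powr (p - 1) * ?e"
  proof -
    have "?e powr p = ?e * ?e powr (p - 1)" using e by (simp add: powr_mult_base)
    then show ?thesis using e by (simp add: powr_mult mult_ac)
  qed
  also have "\<dots> \<le> \<nu> k powr (p - 1) * ?e"
    using eps_1_le[OF assms] p assms e
    by (intro mult_right_mono powr_mono2) (auto simp: field_simps)
  also have "\<dots> \<le> eps_p p \<nu> k powr p"
    unfolding eps_p_powr eps_1 using p by (intro powr_diff_ge nu_mono) auto
  finally have "(?e * real k powr (1 - 1 / p)) powr p \<le> eps_p p \<nu> k powr p" .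
  then have *: "((?e * real k powr (1 - 1 / p)) powr p) powr (1 / p) \<le> (eps_p p \<nu> k powr p) powr (1 / p)"
    by (rule powr_mono2[rotated 2]) (use p in auto)
  have c: "(x powr p) powr (1 / p) = x" if "x \<ge> 0" for x :: real
    using p that by (simp add: powr_powr)
  show ?thesis using * e unfolding c[OF eps_p_nonneg] by (subst (asm) c) auto
qed

lemma eps_p_tendsto_0: "(\<lambda>k. eps_p p \<nu> k) \<longlonglongrightarrow> 0"
proof (rule tendsto_sandwich[OF _ _ tendsto_const lim0])
  show "\<forall>\<^sub>F k in sequentially. eps_p p \<nu> k \<le> \<nu> k / real k powr (1 / p)"
    using eventually_ge_at_top[of 1] by eventually_elim (rule eps_p_le)
qed auto

lemma eps_p_le_nu_1: "eps_p p \<nu> k \<le> \<nu> 1"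
proof (cases "k = 0")
  case False
  then show ?thesis using eps_p_le[of k] ratio_antimono[of 1 k] by auto
qed (simp add: eps_p_def nu_nonneg)

text \<open>The sequence \<open>eps_p p \<nu>\<close> need not be monotone, but beyond index \<open>n\<close> it
  stays below \<open>\<nu> n / n powr (1 / p)\<close>.\<close>
lemma sum_eps_p_le:
  assumes "finite S" "card S \<le> n" "0 \<notin> S"
  shows "(\<Sum>k\<in>S. eps_p p \<nu> k powr p) \<le> 2 * \<nu> n powr p"
proof (cases "n = 0")
  case False
  have "(\<Sum>k\<in>S. eps_p p \<nu> k powr p)
      = (\<Sum>k\<in>S \<inter> {1..n}. eps_p p \<nu> k powr p) + (\<Sum>k\<in>S - {1..n}. eps_p p \<nu> k powr p)"
    using assms(1) by (metis sum.Int_Diff)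
  also have "(\<Sum>k\<in>S \<inter> {1..n}. eps_p p \<nu> k powr p) \<le> (\<Sum>k=1..n. eps_p p \<nu> k powr p)"
    by (intro sum_mono2) auto
  also have "\<dots> = \<nu> n powr p" by (rule sum_eps_p_powr)
  \<comment> \<open>At most \<open>n\<close> indices lie beyond \<open>n\<close>, and each
    contributes at most \<open>\<nu> n powr p / n\<close>; this yields the second copy of
    \<open>\<nu> n powr p\<close>.\<close>
  also have "(\<Sum>k\<in>S - {1..n}. eps_p p \<nu> k powr p) \<le> (\<Sum>k\<in>S - {1..n}. \<nu> n powr p / real n)"
  proof (intro sum_mono)
    fix k assume "k \<in> S - {1..n}"
    then have k: "k \<ge> n" "k \<ge> 1" using assms(3) by (auto intro: Suc_leI gr0I)
    show "eps_p p \<nu> k powr p \<le> \<nu> n powr p / real n"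
    proof -
      have "\<nu> k powr p / real k \<le> \<nu> n powr p / real n"
        using nu_powr_mult_le[of n k] k False by (simp add: field_simps)
      then show ?thesis using eps_p_powr_le[OF k(2)] by linarith
    qed
  qed
  also have "\<dots> = real (card (S - {1..n})) * (\<nu> n powr p / real n)" by simp
  also have "\<dots> \<le> real n * (\<nu> n powr p / real n)"
    using assms card_Diff_subset_Int[of S "{1..n}"]
    by (intro mult_right_mono) (auto intro: order.trans[OF card_mono[of S]])
  finally show ?thesis using False by simp
qed (use assms in auto)

lemma nu_double_powr: "\<nu> (2 * n) powr p \<le> 2 * \<nu> n powr p"
  using nu_powr_mult_le[of n "2 * n"] by (cases "n = 0") auto

section \<open>Comparison of the series (ii)-(v)\<close>

text \<open>By the mean value theorem the difference equals \<open>z powr (-(1 + 1 / p)) / p\<close>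
  for some \<open>z\<close> strictly between \<open>j\<close> and \<open>Suc j\<close>, and this
  power is decreasing in \<open>z\<close>.\<close>

lemma Delta_powr_bounds:
  assumes "j \<ge> (1::nat)"
  shows "real (Suc j) powr (-(1 + 1 / p)) / p \<le> Delta (\<lambda>j. real j powr (-(1 / p))) j"
    and "Delta (\<lambda>j. real j powr (-(1 / p))) j \<le> real j powr (-(1 + 1 / p)) / p"
proof -
  have "\<exists>z. real j < z \<and> z < real (Suc j) \<and>
      (real (Suc j) powr (-(1 / p)) - real j powr (-(1 / p)))
        = (real (Suc j) - real j) * (-(1 / p) * z powr (-(1 / p) - 1))"
    using assms by (intro MVT2) (auto intro!: derivative_eq_intros DERIV_powr simp: field_simps)
  then obtain z where z: "real j < z" "z < real (Suc j)"
    "real (Suc j) powr (-(1 / p)) - real j powr (-(1 / p))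
        = (real (Suc j) - real j) * (-(1 / p) * z powr (-(1 / p) - 1))" by blast
  have p': "-(1 + 1 / p) \<le> 0"
  proof -
    have "0 \<le> 1 / p" using p by simp
    then show ?thesis by linarith
  qed
  have D: "Delta (\<lambda>j. real j powr (-(1 / p))) j = z powr (-(1 + 1 / p)) / p"
  proof -
    have E: "-(1 / p) - 1 = -(1 + 1 / p)" by simp
    show ?thesis using z(3) unfolding Delta_def E by simp
  qed
  show "real (Suc j) powr (-(1 + 1 / p)) / p \<le> Delta (\<lambda>j. real j powr (-(1 / p))) j"
    unfolding D using z assms by (intro divide_right_mono powr_mono2' p') (use p in auto)
  show "Delta (\<lambda>j. real j powr (-(1 / p))) j \<le> real j powr (-(1 + 1 / p)) / p"
    unfolding D using z assms by (intro divide_right_mono powr_mono2' p') (use p in auto)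
qed

lemma summable_II_iff_III:
  "summable (\<lambda>k. \<nu> (Suc k) * real (Suc k) powr (-(1 + 1 / p))) \<longleftrightarrow>
   summable (\<lambda>k. Delta (\<lambda>j. real j powr (-(1 / p))) (Suc k) * \<nu> (Suc k))" (is "summable ?a \<longleftrightarrow> summable ?b")
proof
  assume s: "summable ?a"
  have "norm (?b k) \<le> ?a k / p" for k
  proof -
    have "0 \<le> Delta (\<lambda>j. real j powr (-(1 / p))) (Suc k)"
      by (rule order.trans[OF _ Delta_powr_bounds(1)]) (use p in auto)
    then show ?thesis
      using mult_right_mono[OF Delta_powr_bounds(2)[of "Suc k"], of "\<nu> (Suc k)"]
      by (simp add: mult.commute)
  qed
  with summable_divide[OF s, of p] show "summable ?b" by (rule summable_comparison_test')
next
  assume s: "summable ?b"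
  have "norm (?a k) \<le> (p * 2 powr (1 + 1 / p)) * ?b k" for k
  proof -
    \<comment> \<open>The lower bound for \<open>Delta\<close> involves the next index. Passing to
      it costs the factor \<open>2 powr (1 + 1 / p)\<close>, because
      \<open>k + 2 \<le> 2 * (k + 1)\<close>.\<close>
    have "real (Suc k) powr (-(1 + 1 / p)) = 2 powr (1 + 1 / p) * (2 * real (Suc k)) powr (-(1 + 1 / p))"
      unfolding powr_mult by (simp add: powr_add[symmetric] mult.assoc[symmetric])
    also have "\<dots> \<le> 2 powr (1 + 1 / p) * real (Suc (Suc k)) powr (-(1 + 1 / p))"
    proof (intro mult_left_mono powr_mono2')
      have "0 \<le> 1 / p" using p by simp
      then show "-(1 + 1 / p) \<le> 0" by linarith
    qed auto
    also have "\<dots> \<le> 2 powr (1 + 1 / p) * (p * Delta (\<lambda>j. real j powr (-(1 / p))) (Suc k))"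
      using Delta_powr_bounds(1)[of "Suc k"] p by (intro mult_left_mono) (auto simp: field_simps)
    finally have "\<nu> (Suc k) * real (Suc k) powr (-(1 + 1 / p))
        \<le> \<nu> (Suc k) * (2 powr (1 + 1 / p) * (p * Delta (\<lambda>j. real j powr (-(1 / p))) (Suc k)))"
      by (intro mult_left_mono) auto
    then show ?thesis by (simp add: mult_ac)
  qed
  with summable_mult[OF s, of "p * 2 powr (1 + 1 / p)"] show "summable ?a" by (rule summable_comparison_test')
qed

lemma summable_III_iff_IV:
  "summable (\<lambda>k. Delta (\<lambda>j. real j powr (-(1 / p))) (Suc k) * \<nu> (Suc k)) \<longleftrightarrow>
   summable (\<lambda>k. eps_p 1 \<nu> (Suc k) * real (Suc k) powr (-(1 / p)))" (is "summable ?b \<longleftrightarrow> summable ?c")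
proof -
  \<comment> \<open>Pairing \<open>\<nu> n\<close> with the weight at \<open>Suc n\<close> makes the
    summation by parts exact term by term, so the two series differ by a telescoping one.\<close>
  define r where "r n = \<nu> n * real (Suc n) powr (-(1 / p))" for n
  have c: "?c k = ?b k + (r (Suc k) - r k)" for k
    by (simp add: eps_1 Delta_def r_def algebra_simps)
  have "r \<longlonglongrightarrow> 0"
  proof (rule tendsto_sandwich[OF _ _ tendsto_const lim0])
    have "r n \<le> \<nu> n / real n powr (1 / p)" if "n \<ge> 1" for n
    proof -
      have "real (Suc n) powr (-(1 / p)) \<le> real n powr (-(1 / p))"
        using p that by (intro powr_mono2') auto
      then show ?thesis
        by (simp add: r_def powr_minus divide_inverse mult_left_mono)
    qed
    then show "\<forall>\<^sub>F n in sequentially. r n \<le> \<nu> n / real n powr (1 / p)"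
      unfolding eventually_sequentially by blast
  qed (auto simp: r_def)
  then have s: "summable (\<lambda>k. r (Suc k) - r k)"
    by (intro telescope_summable)
  show ?thesis
    unfolding c using s summable_add[OF _ s] summable_diff[of "\<lambda>k. ?b k + (r (Suc k) - r k)", OF _ s] by auto
qed

lemma summable_II_imp_V:
  assumes "summable (\<lambda>k. \<nu> (Suc k) * real (Suc k) powr (-(1 + 1 / p)))"
  shows "summable (\<lambda>k. eps_p p \<nu> (Suc k) / real (Suc k))"
proof (rule summable_comparison_test'[OF assms])
  fix k
  have "eps_p p \<nu> (Suc k) / real (Suc k) \<le> \<nu> (Suc k) / real (Suc k) powr (1 / p) / real (Suc k)"
    by (intro divide_right_mono eps_p_le) auto
  also have "\<dots> = \<nu> (Suc k) * real (Suc k) powr (-(1 + 1 / p))"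
    by (simp add: powr_add powr_minus powr_diff divide_inverse)
  finally show "norm (eps_p p \<nu> (Suc k) / real (Suc k)) \<le> \<nu> (Suc k) * real (Suc k) powr (-(1 + 1 / p))"
    by simp
qed

lemma summable_V_imp_IV:
  assumes "summable (\<lambda>k. eps_p p \<nu> (Suc k) / real (Suc k))"
  shows "summable (\<lambda>k. eps_p 1 \<nu> (Suc k) * real (Suc k) powr (-(1 / p)))"
proof (rule summable_comparison_test'[OF assms])
  fix k
  have "eps_p 1 \<nu> (Suc k) * real (Suc k) powr (-(1 / p))
      = eps_p 1 \<nu> (Suc k) * real (Suc k) powr (1 - 1 / p) / real (Suc k)"
    by (simp add: powr_diff powr_minus divide_inverse)
  also have "\<dots> \<le> eps_p p \<nu> (Suc k) / real (Suc k)"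
    by (intro divide_right_mono eps_1_le_eps_p) auto
  finally show "norm (eps_p 1 \<nu> (Suc k) * real (Suc k) powr (-(1 / p))) \<le> eps_p p \<nu> (Suc k) / real (Suc k)"
    by (simp add: eps_1 nu_mono)
qed

end

section \<open>The Dirichlet kernel\<close>

text \<open>Jordan's inequality: the concave sine lies above its chord from \<open>0\<close> to
  \<open>pi / 2\<close>.\<close>

lemma sin_half_ge:
  assumes "0 \<le> t" "t \<le> pi"
  shows "t / pi \<le> sin (t / 2)"
proof -
  have "convex_on {0..pi / 2} (\<lambda>x. - sin x)"
    by (rule f''_ge0_imp_convex[where f' = "\<lambda>x. - cos x" and f'' = sin])
       (auto intro!: derivative_eq_intros sin_ge_zero)
  from convex_onD[OF this, of "t / pi" 0 "pi / 2"] show ?thesis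
    using assms by (simp add: field_simps)
qed

text \<open>Half of the kernel \<open>1 + 2 * cos t + ... + 2 * cos (n * t)\<close>; with this
  normalization the partial sum is \<open>1 / pi\<close> times the integral against the kernel over
  a period.\<close>

definition dirichlet :: "nat \<Rightarrow> real \<Rightarrow> real" where
  "dirichlet n t = 1 / 2 + (\<Sum>k=1..n. cos (real k * t))"

lemma continuous_on_dirichlet [continuous_intros]:
  fixes f :: "real \<Rightarrow> real"
  shows "continuous_on A f \<Longrightarrow> continuous_on A (\<lambda>x. dirichlet n (f x))"
  unfolding dirichlet_def by (auto intro!: continuous_intros)

lemma dirichlet_minus [simp]: "dirichlet n (- t) = dirichlet n t"
  by (simp add: dirichlet_def)

lemma dirichlet_periodic: "dirichlet n (t + 2 * pi) = dirichlet n t"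
proof -
  have "cos (real k * (t + 2 * pi)) = cos (real k * t)" for k
    using cos.plus_of_nat[of "real k * t" k] by (simp add: distrib_left)
  then show ?thesis by (simp add: dirichlet_def)
qed

lemma abs_dirichlet_le: "\<bar>dirichlet n t\<bar> \<le> real n + 1 / 2"
proof -
  have "\<bar>\<Sum>k=1..n. cos (real k * t)\<bar> \<le> (\<Sum>k=1..n. \<bar>cos (real k * t)\<bar>)" by (rule sum_abs)
  also have "\<dots> \<le> (\<Sum>k=1..n. 1)" by (intro sum_mono) auto
  finally show ?thesis by (simp add: dirichlet_def)
qed

text \<open>Multiplication by \<open>2 * sin (t / 2)\<close> turns each cosine into a difference of
  sines at neighbouring half-integer frequencies, and the sum telescopes. The product form also
  covers the zeros of \<open>sin (t / 2)\<close>.\<close>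

lemma dirichlet_mult: "2 * sin (t / 2) * dirichlet n t = sin ((real n + 1 / 2) * t)"
proof (induction n)
  case (Suc n)
  have *: "2 * sin (t / 2) * cos (real (Suc n) * t)
      = sin (real (Suc n) * t + t / 2) - sin (real (Suc n) * t - t / 2)"
    by (simp add: sin_add sin_diff)
  have e: "(real (Suc n) + 1 / 2) * t = real (Suc n) * t + t / 2"
    "(real n + 1 / 2) * t = real (Suc n) * t - t / 2"
    by (simp_all add: algebra_simps)
  have "dirichlet (Suc n) t = dirichlet n t + cos (real (Suc n) * t)"
    by (simp add: dirichlet_def)
  then show ?case
    using Suc * unfolding e by (simp add: distrib_left)
qed (simp add: dirichlet_def)

lemma dirichlet_eq:
  assumes "0 < t" "t \<le> pi"
  shows "dirichlet n t = sin ((real n + 1 / 2) * t) / (2 * sin (t / 2))"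
proof -
  have "sin (t / 2) > 0" using assms by (intro sin_gt_zero) auto
  then show ?thesis using dirichlet_mult[of t n] by (simp add: field_simps)
qed

lemma integral_dirichlet: "integral {0..pi} (dirichlet n) = pi / 2"
proof -
  have "((\<lambda>t. 1 / 2 + (\<Sum>k=1..n. cos (real k * t))) has_integral
      (1 / 2 * (pi - 0) + (\<Sum>k=1..n. 0))) {0..pi}"
  proof (intro has_integral_add has_integral_sum)
    show "((\<lambda>t. 1 / 2) has_integral 1 / 2 * (pi - 0)) {0..pi}"
      using has_integral_const_real[of "1 / 2 :: real" 0 pi] by simp
    fix k assume "k \<in> {1..n}"
    then have "((\<lambda>t. cos (real k * t)) has_integral
        (sin (real k * pi) / real k - sin (real k * 0) / real k)) {0..pi}"
      by (intro fundamental_theorem_of_calculus)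
         (auto intro!: derivative_eq_intros simp flip: has_real_derivative_iff_has_vector_derivative)
    then show "((\<lambda>t. cos (real k * t)) has_integral 0) {0..pi}" by simp
  qed auto
  moreover have "dirichlet n = (\<lambda>t. 1 / 2 + (\<Sum>k=1..n. cos (real k * t)))"
    by (auto simp: dirichlet_def)
  ultimately show ?thesis by (simp add: integral_unique)
qed

section \<open>Partial sums as Dirichlet integrals\<close>

lemma fourier_partial_sum_eq_dirichlet:
  assumes f: "continuous_on UNIV f"
  shows "fourier_partial_sum f n x = (1 / pi) * integral {0..2 * pi} (\<lambda>t. f t * dirichlet n (t - x))"
proof -
  let ?I = "{0..2 * pi}"
  have c: "((\<lambda>t. f t * cos (real k * t)) has_integral pi * fourier_cos f k) ?I" for k
    unfolding fourier_cos_def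
    by (auto intro!: integrable_integral integrable_continuous_real continuous_intros
          continuous_on_subset[OF f])
  have s: "((\<lambda>t. f t * sin (real k * t)) has_integral pi * fourier_sin f k) ?I" for k
    unfolding fourier_sin_def
    by (auto intro!: integrable_integral integrable_continuous_real continuous_intros
          continuous_on_subset[OF f])
  \<comment> \<open>The constant term is kept as \<open>cos (real 0 * t)\<close> so that
    \<open>c\<close> applies to it as well.\<close>
  have "((\<lambda>t. f t * cos (real 0 * t) * (1 / 2) + (\<Sum>k=1..n.
        f t * cos (real k * t) * cos (real k * x) + f t * sin (real k * t) * sin (real k * x)))
      has_integral pi * fourier_cos f 0 * (1 / 2) + (\<Sum>k=1..n.
        pi * fourier_cos f k * cos (real k * x) + pi * fourier_sin f k * sin (real k * x))) ?I"
    by (intro has_integral_add has_integral_sum has_integral_mult_left c s) auto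
  moreover have "pi * fourier_cos f 0 * (1 / 2) + (\<Sum>k=1..n.
        pi * fourier_cos f k * cos (real k * x) + pi * fourier_sin f k * sin (real k * x))
      = pi * fourier_partial_sum f n x"
    by (simp add: fourier_partial_sum_def algebra_simps sum_distrib_left)
  moreover have "f t * cos (real 0 * t) * (1 / 2) + (\<Sum>k=1..n.
        f t * cos (real k * t) * cos (real k * x) + f t * sin (real k * t) * sin (real k * x))
      = f t * dirichlet n (t - x)" for t
    by (simp add: dirichlet_def algebra_simps sum_distrib_left cos_diff)
  ultimately show ?thesis by (simp add: integral_unique)
qed

lemma integral_periodic:
  fixes G :: "real \<Rightarrow> real"
  assumes G: "continuous_on UNIV G" and per: "\<And>x. G (x + 2 * pi) = G x"
    and a: "0 \<le> a" "a \<le> 2 * pi"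
  shows "integral {a..a + 2 * pi} G = integral {0..2 * pi} G"
proof -
  have int: "G integrable_on {c..d}" for c d
    by (intro integrable_continuous_real continuous_on_subset[OF G]) auto
  have "integral {a..a + 2 * pi} G = integral {a..2 * pi} G + integral {2 * pi..a + 2 * pi} G"
    using a by (intro Henstock_Kurzweil_Integration.integral_combine[symmetric] int) auto
  also have "integral {2 * pi..a + 2 * pi} G = integral {0..a} G"
    using integral_shift_real_ivl[of "2 * pi" "2 * pi" "a + 2 * pi" G] by (simp add: per)
  also have "integral {a..2 * pi} G + integral {0..a} G = integral {0..2 * pi} G"
    using Henstock_Kurzweil_Integration.integral_combine[of 0 a "2 * pi" G] a int by simp
  finally show ?thesis .
qed

text \<open>The period window is moved to \<open>[x - pi, x + pi]\<close> and folded at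
  \<open>x\<close>, the kernel being even. The range of \<open>x\<close> is one full period, chosen
  so that \<open>x - pi\<close> lies in \<open>[0, 2 * pi]\<close>, as
  \<open>integral_periodic\<close> demands.\<close>

lemma fourier_partial_sum_eq_symmetric:
  assumes f: "continuous_on UNIV f" and per: "periodic_2pi f"
    and x: "pi \<le> x" "x \<le> 3 * pi"
  shows "fourier_partial_sum f n x
    = (1 / pi) * integral {0..pi} (\<lambda>t. (f (x + t) + f (x - t)) * dirichlet n t)"
proof -
  let ?G = "\<lambda>t. f t * dirichlet n (t - x)" and ?H = "\<lambda>t. f (t + x) * dirichlet n t"
  have G: "continuous_on UNIV ?G" by (intro continuous_intros f)
  have ct: "continuous_on A (\<lambda>t. f (g t))" if "continuous_on A g" for A g
    using continuous_on_compose2[OF f that] by auto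
  have int: "(\<lambda>t. f (g t) * dirichlet n t) integrable_on {c..d}" if "continuous_on {c..d} g" for c d g
    by (intro integrable_continuous_real continuous_intros ct that)
  have "integral {0..2 * pi} ?G = integral {x - pi..x + pi} ?G"
  proof -
    have "?G (t + 2 * pi) = ?G t" for t
      using per dirichlet_periodic[of n "t - x"] by (simp add: periodic_2pi_def algebra_simps)
    then show ?thesis
      using integral_periodic[OF G, of "x - pi"] x by (simp add: algebra_simps)
  qed
  also have "\<dots> = integral {- pi..pi} ?H"
    using integral_shift_real_ivl[of "x - pi" x "x + pi" ?G] by simp
  also have "\<dots> = integral {- pi..0} ?H + integral {0..pi} ?H"
    by (intro Henstock_Kurzweil_Integration.integral_combine[symmetric] int continuous_intros) auto
  also have "integral {- pi..0} ?H = integral {0..pi} (\<lambda>t. f (x - t) * dirichlet n t)"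
    using Henstock_Kurzweil_Integration.integral_reflect_real[of pi 0 "\<lambda>t. f (x - t) * dirichlet n t"]
    by (simp add: add.commute)
  also have "\<dots> + integral {0..pi} ?H = integral {0..pi} (\<lambda>t. f (x - t) * dirichlet n t + ?H t)"
    by (intro integral_add[symmetric] int continuous_intros)
  also have "\<dots> = integral {0..pi} (\<lambda>t. (f (x + t) + f (x - t)) * dirichlet n t)"
    by (intro integral_cong) (simp add: algebra_simps)
  finally show ?thesis by (simp add: fourier_partial_sum_eq_dirichlet[OF f])
qed

lemma fourier_partial_sum_diff:
  assumes f: "continuous_on UNIV f" and per: "periodic_2pi f"
    and x: "pi \<le> x" "x \<le> 3 * pi"
  shows "fourier_partial_sum f n x - f x
    = (1 / pi) * integral {0..pi} (\<lambda>t. (f (x + t) + f (x - t) - 2 * f x) * dirichlet n t)"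
proof -
  have ct: "continuous_on A (\<lambda>t. f (g t))" if "continuous_on A g" for A g
    using continuous_on_compose2[OF f that] by auto
  have "integral {0..pi} (\<lambda>t. (f (x + t) + f (x - t)) * dirichlet n t - 2 * f x * dirichlet n t)
     = integral {0..pi} (\<lambda>t. (f (x + t) + f (x - t)) * dirichlet n t)
       - integral {0..pi} (\<lambda>t. 2 * f x * dirichlet n t)"
    by (intro integral_diff integrable_continuous_real continuous_intros ct)
  also have "integral {0..pi} (\<lambda>t. 2 * f x * dirichlet n t) = pi * f x"
    using integral_dirichlet[of n] by simp
  finally show ?thesis
    by (simp add: fourier_partial_sum_eq_symmetric[OF assms] left_diff_distrib right_diff_distrib)
qed

section \<open>Bounding a Dirichlet integral by alternating sums\<close>

lemma summation_by_parts:
  fixes u w :: "nat \<Rightarrow> real"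
  assumes "1 \<le> m"
  shows "(\<Sum>j=1..m. u j * w j)
    = (\<Sum>j=1..<m. (\<Sum>i=1..j. u i) * (w j - w (Suc j))) + (\<Sum>i=1..m. u i) * w m"
  using assms
proof (induction rule: dec_induct)
  case (step m)
  then show ?case by (simp add: algebra_simps)
qed simp

text \<open>All blocks of length \<open>h\<close> are moved onto \<open>[0, h]\<close>, so that
  cancellation between blocks can be exploited pointwise under one integral.\<close>

lemma integral_blocks:
  fixes G :: "real \<Rightarrow> real"
  assumes G: "continuous_on UNIV G" and h: "h \<ge> 0"
  shows "integral {h..real (Suc m) * h} G = integral {0..h} (\<lambda>t. \<Sum>j=1..m. G (t + real j * h))"
proof (induction m)
  case (Suc m)
  have ct: "continuous_on A (\<lambda>t. G (g t))" if "continuous_on A g" for A g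
    using continuous_on_compose2[OF G that] by auto
  have "integral {h..real (Suc (Suc m)) * h} G
      = integral {h..real (Suc m) * h} G + integral {real (Suc m) * h..real (Suc (Suc m)) * h} G"
    using h by (intro Henstock_Kurzweil_Integration.integral_combine[symmetric] integrable_continuous_real continuous_on_subset[OF G])
      (auto simp: algebra_simps)
  also have "integral {real (Suc m) * h..real (Suc (Suc m)) * h} G
      = integral {0..h} (\<lambda>t. G (t + real (Suc m) * h))"
    using integral_shift_real_ivl[of "real (Suc m) * h" "real (Suc m) * h" "real (Suc (Suc m)) * h" G]
    by (simp add: algebra_simps)
  also have "integral {h..real (Suc m) * h} G + \<dots>
      = integral {0..h} (\<lambda>t. (\<Sum>j=1..m. G (t + real j * h)) + G (t + real (Suc m) * h))"
    unfolding Suc by (intro integral_add[symmetric] integrable_continuous_real continuous_intros ct)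
  finally show ?case by simp
qed simp

lemma abs_sin_diff_le:
  fixes x y :: real
  shows "\<bar>sin x - sin y\<bar> \<le> \<bar>x - y\<bar>"
proof -
  have "\<bar>sin x - sin y\<bar> = 2 * \<bar>sin ((x - y) / 2)\<bar> * \<bar>cos ((x + y) / 2)\<bar>"
    by (simp add: sin_diff_sin abs_mult)
  also have "\<dots> \<le> 2 * \<bar>(x - y) / 2\<bar> * 1"
    by (intro mult_mono mult_left_mono abs_sin_x_le_abs_x) auto
  finally show ?thesis by simp
qed

text \<open>The terms of the bound belong to the first block \<open>[0, h]\<close>
  (\<open>pi * \<eta>\<close>), the last half block (\<open>B * h\<close>) and the blocks between
  them. In the latter the alternating sums of \<open>g\<close> are bounded by
  \<open>j * \<eta>\<close> for \<open>j \<le> K\<close> and by \<open>a j\<close> afterwards. The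
  smallness range of \<open>g\<close> reaches \<open>Suc K * h\<close> because the points used are
  \<open>t + j * h\<close> with \<open>t \<le> h\<close> and \<open>j \<le> K\<close>.\<close>

lemma dirichlet_integral_bound:
  fixes g :: "real \<Rightarrow> real" and n K :: nat and \<eta> B :: real and a :: "nat \<Rightarrow> real"
  defines "h \<equiv> pi / (real n + 1 / 2)"
  assumes n: "2 \<le> n" and g: "continuous_on UNIV g"
    and B: "\<And>t. \<bar>g t\<bar> \<le> B"
    and \<eta>: "\<And>t. 0 \<le> t \<Longrightarrow> t \<le> real (Suc K) * h \<Longrightarrow> \<bar>g t\<bar> \<le> \<eta>"
    and a: "\<And>t k. 0 \<le> t \<Longrightarrow> t \<le> h \<Longrightarrow> k < n \<Longrightarrow> \<bar>\<Sum>j=1..k. (-1) ^ j * g (t + real j * h)\<bar> \<le> a k"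
  shows "\<bar>integral {0..pi} (\<lambda>t. g t * dirichlet n t)\<bar>
    \<le> pi * \<eta> + B * h + (3 * (real K * \<eta> + (\<Sum>j=Suc K..<n. a j / (real j)\<^sup>2))
      + 2 * a (n - 1) / real (n - 1))"
proof -
  define L where "L = real n + 1 / 2"
  let ?G = "\<lambda>t. g t * dirichlet n t"
  define w where "w s = 1 / (2 * sin (s / 2))" for s :: real
  have h: "h > 0" and L: "L > 0" and hL: "L * h = pi"
    by (auto simp: h_def L_def field_simps add_pos_nonneg)
  have nh: "real n * h + h / 2 = pi"
    using hL by (simp add: L_def algebra_simps)
  have G: "continuous_on A ?G" for A
    by (intro continuous_intros continuous_on_subset[OF g]) auto
  have int: "?G integrable_on {c..d}" for c d
    by (intro integrable_continuous_real G)
  have \<eta>0: "\<eta> \<ge> 0" using \<eta>[of 0] h by (smt (verit) abs_ge_zero mult_nonneg_nonneg of_nat_0_le_iff)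
  have B0: "B \<ge> 0" using B[of 0] by linarith
  have a0: "a k \<ge> 0" if "k < n" for k using a[of 0 k] that h by linarith

  have w_pos: "sin (s / 2) > 0" and w_ge: "s / pi \<le> sin (s / 2)" if "0 < s" "s \<le> pi" for s
    using that sin_gt_zero[of "s / 2"] sin_half_ge[of s] by auto
  have w_bound: "\<bar>w s\<bar> \<le> pi / (2 * r)" if "0 < r" "r \<le> s" "s \<le> pi" for r s
  proof -
    have "r / pi \<le> s / pi" using that by (simp add: divide_right_mono)
    then have "r / pi \<le> sin (s / 2)" using w_ge[of s] that by simp
    then have "1 / (2 * sin (s / 2)) \<le> 1 / (2 * (r / pi))"
      using that by (intro divide_left_mono mult_pos_pos mult_left_mono) (auto intro: w_pos)
    then show ?thesis using w_pos[of s] that by (simp add: w_def field_simps)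
  qed
  \<comment> \<open>In the difference of the reciprocals the numerator is at most
    \<open>h / 2\<close>, the sine being 1-Lipschitz, and Jordan's inequality bounds both factors of
    the denominator from below.\<close>
  have w_diff: "\<bar>w s - w (s + h)\<bar> \<le> pi\<^sup>2 * h / (4 * r\<^sup>2)" if "0 < r" "r \<le> s" "s + h \<le> pi" for r s
  proof -
    have 1: "r / pi \<le> sin (s / 2)" "r / pi \<le> sin ((s + h) / 2)"
      using w_ge[of s] w_ge[of "s + h"] that h
      by (auto intro: order.trans[rotated] simp: divide_right_mono)
    have p: "sin (s / 2) > 0" "sin ((s + h) / 2) > 0"
      using w_pos[of s] w_pos[of "s + h"] that h by auto
    have "\<bar>sin ((s + h) / 2) - sin (s / 2)\<bar> \<le> \<bar>(s + h) / 2 - s / 2\<bar>"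
      by (rule abs_sin_diff_le)
    also have "\<dots> = h / 2" using h by (simp add: field_simps)
    finally have 2: "\<bar>sin ((s + h) / 2) - sin (s / 2)\<bar> \<le> h / 2" .
    have 3: "(r / pi)\<^sup>2 \<le> sin (s / 2) * sin ((s + h) / 2)"
      unfolding power2_eq_square using 1 that p by (intro mult_mono) auto
    have "w s - w (s + h) = (sin ((s + h) / 2) - sin (s / 2)) / (2 * (sin (s / 2) * sin ((s + h) / 2)))"
      using p by (simp add: w_def field_simps)
    then have "\<bar>w s - w (s + h)\<bar>
        = \<bar>sin ((s + h) / 2) - sin (s / 2)\<bar> / (2 * (sin (s / 2) * sin ((s + h) / 2)))"
      using p by (simp add: abs_mult)
    also have "\<dots> \<le> (h / 2) / (2 * (r / pi)\<^sup>2)"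
      using 2 3 that h by (intro frac_le) auto
    also have "\<dots> = pi\<^sup>2 * h / (4 * r\<^sup>2)" by (simp add: power_divide)
    finally show ?thesis .
  qed
  have pi2: "pi\<^sup>2 \<le> 12"
  proof -
    have "pi\<^sup>2 \<le> 3.2\<^sup>2" using pi_approx by (intro power_mono) auto
    then show ?thesis by (simp add: power2_eq_square)
  qed

  \<comment> \<open>On the first block only the trivial kernel bound \<open>L\<close> is used; it is
    harmless because \<open>L * h = pi\<close>.\<close>
  have first: "\<bar>integral {0..h} ?G\<bar> \<le> pi * \<eta>"
  proof -
    have "norm (integral {0..h} ?G) \<le> (\<eta> * L) * (h - 0)"
    proof (rule integral_bound)
      fix t assume t: "t \<in> {0..h}"
      have "\<bar>g t\<bar> \<le> \<eta>"
        using t h by (intro \<eta>) (auto simp: distrib_right intro: add_increasing2)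
      then show "norm (?G t) \<le> \<eta> * L"
        using abs_dirichlet_le[of n t] \<eta>0 by (auto simp: abs_mult L_def intro!: mult_mono)
    qed (use h G in auto)
    then show ?thesis using hL by (simp add: mult.assoc mult.commute[of pi])
  qed

  have last: "\<bar>integral {real n * h..pi} ?G\<bar> \<le> B * h"
  proof -
    have "norm (integral {real n * h..pi} ?G) \<le> (B * 2) * (pi - real n * h)"
    proof (rule integral_bound)
      fix t assume t: "t \<in> {real n * h..pi}"
      have nh0: "real n * h \<ge> pi / 2"
      proof -
        have "2 * h \<le> real n * h" using n h by (intro mult_right_mono) auto
        then show ?thesis using nh h by linarith
      qed
      have t0: "0 < t" "pi / 2 \<le> t" using t nh0 pi_gt_zero by (auto intro: order.strict_trans2[of _ "pi / 2"])
      have "\<bar>dirichlet n t\<bar> = \<bar>sin (L * t)\<bar> * \<bar>w t\<bar>"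
        using dirichlet_eq[of t n] t t0 by (simp add: w_def L_def abs_mult)
      also have "\<dots> \<le> 1 * (pi / (2 * (pi / 2)))"
        using t0 t by (intro mult_mono w_bound) auto
      finally have "\<bar>dirichlet n t\<bar> \<le> 2" by simp
      then show "norm (?G t) \<le> B * 2"
        using B[of t] B0 by (auto simp: abs_mult intro!: mult_mono)
    qed (use nh h G in auto)
    moreover have "pi - real n * h = h / 2" using nh by simp
    ultimately show ?thesis by simp
  qed

  define m where "m = n - 1"
  have m: "1 \<le> m" "n = Suc m" "m < n" using n by (auto simp: m_def)
  let ?R = "3 * (real K * \<eta> + (\<Sum>j=Suc K..<n. a j / (real j)\<^sup>2)) + 2 * a m / real m"
  \<comment> \<open>Each weight is of order \<open>1 / h\<close>, which integration over
    \<open>[0, h]\<close> cancels.\<close>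
  have pw: "\<bar>\<Sum>j=1..m. ?G (t + real j * h)\<bar> \<le> ?R / h" if t: "0 \<le> t" "t \<le> h" for t
  proof -
    define u where "u j = (-1) ^ j * g (t + real j * h)" for j
    define A where "A k = (\<Sum>j=1..k. u j)" for k
    define v where "v j = w (t + real j * h)" for j
    have le_pi: "t + real j * h \<le> pi" if "j \<le> m" for j
    proof -
      have "real j * h \<le> real m * h" using that h by (intro mult_right_mono) auto
      moreover have "real n * h = real m * h + h" using m by (simp add: algebra_simps)
      ultimately show ?thesis using t nh h by linarith
    qed
    have pos: "0 < real j * h" if "1 \<le> j" for j using that h by simp
    \<comment> \<open>A shift by \<open>j * h\<close> adds \<open>j * pi\<close> to the phase
      \<open>L * t\<close>; this is where the alternating signs come from.\<close>
    have G_eq: "?G (t + real j * h) = sin (L * t) * (u j * v j)" if j: "j \<in> {1..m}" for j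
    proof -
      have "0 < t + real j * h" "t + real j * h \<le> pi"
        using pos[of j] le_pi[of j] t j by (auto intro: add_nonneg_pos)
      then have "dirichlet n (t + real j * h) = sin (L * (t + real j * h)) * v j"
        using dirichlet_eq[of "t + real j * h" n] by (simp add: w_def v_def L_def)
      also have "L * (t + real j * h) = L * t + real j * pi"
        using hL by (simp add: algebra_simps flip: hL)
      also have "sin (L * t + real j * pi) = (-1) ^ j * sin (L * t)"
        by (simp add: sin_add)
      finally show ?thesis by (simp add: u_def)
    qed
    have A1: "\<bar>A k\<bar> \<le> a k" if "k < n" for k
      using a[OF t that] by (simp add: A_def u_def)
    have A2: "\<bar>A k\<bar> \<le> real k * \<eta>" if "k \<le> K" for k
    proof -
      have "\<bar>A k\<bar> \<le> (\<Sum>j=1..k. \<bar>u j\<bar>)" unfolding A_def by (rule sum_abs)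
      also have "\<dots> \<le> (\<Sum>j=1..k. \<eta>)"
      proof (intro sum_mono)
        fix j assume j: "j \<in> {1..k}"
        have "t + real j * h \<le> h + real K * h"
          using j that t h by (intro add_mono mult_right_mono) auto
        then have "\<bar>g (t + real j * h)\<bar> \<le> \<eta>"
          using t h by (intro \<eta>) (auto simp: algebra_simps)
        then show "\<bar>u j\<bar> \<le> \<eta>" by (simp add: u_def abs_mult)
      qed
      finally show ?thesis by simp
    qed
    have v1: "\<bar>v m\<bar> \<le> 2 / (real m * h)"
    proof -
      have "\<bar>v m\<bar> \<le> pi / (2 * (real m * h))"
        unfolding v_def using t le_pi[of m] pos[of m] m by (intro w_bound) auto
      also have "\<dots> \<le> 4 / (2 * (real m * h))"
        using pi_less_4 pos[of m] m by (intro divide_right_mono) auto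
      finally show ?thesis by (simp add: mult.commute)
    qed
    \<comment> \<open>\<open>w_diff\<close> with \<open>r = j * h\<close>; the constant
      \<open>3\<close> is \<open>12 / 4\<close>, from \<open>pi\<^sup>2 \<le> 12\<close>.\<close>
    have v2: "\<bar>v j - v (Suc j)\<bar> \<le> 3 / ((real j)\<^sup>2 * h)" if j: "j \<in> {1..<m}" for j
    proof -
      have "\<bar>v j - v (Suc j)\<bar> \<le> pi\<^sup>2 * h / (4 * (real j * h)\<^sup>2)"
        unfolding v_def using w_diff[of "real j * h" "t + real j * h"] t le_pi[of "Suc j"] pos[of j] j
        by (simp add: algebra_simps)
      also have "\<dots> \<le> 12 * h / (4 * (real j * h)\<^sup>2)"
        using h pi2 by (intro divide_right_mono mult_right_mono) auto
      also have "\<dots> = 3 / ((real j)\<^sup>2 * h)" using h j by (simp add: power2_eq_square)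
      finally show ?thesis .
    qed
    have "\<bar>\<Sum>j=1..m. u j * v j\<bar> = \<bar>(\<Sum>j=1..<m. A j * (v j - v (Suc j))) + A m * v m\<bar>"
      unfolding A_def by (subst summation_by_parts[OF m(1)]) simp
    also have "\<dots> \<le> (\<Sum>j=1..<m. \<bar>A j\<bar> * \<bar>v j - v (Suc j)\<bar>) + \<bar>A m\<bar> * \<bar>v m\<bar>"
      by (rule order.trans[OF abs_triangle_ineq add_mono[OF order.trans[OF sum_abs]]])
         (auto simp: abs_mult)
    also have "\<dots> \<le> (\<Sum>j=1..<m. \<bar>A j\<bar> * (3 / ((real j)\<^sup>2 * h))) + a m * (2 / (real m * h))"
      using A1[OF m(3)] v1 by (intro add_mono sum_mono mult_left_mono v2 mult_mono) auto
    \<comment> \<open>The bound is written with indicators because \<open>K\<close> may be smaller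
      or larger than \<open>m\<close>. For \<open>j \<le> K\<close> the bound
      \<open>j * \<eta>\<close> leaves \<open>3 * \<eta> / (j * h)\<close>, estimated by
      \<open>3 * \<eta> / h\<close>.\<close>
    also have "(\<Sum>j=1..<m. \<bar>A j\<bar> * (3 / ((real j)\<^sup>2 * h)))
        \<le> (\<Sum>j=1..<m. (if j \<in> {1..K} then 3 * \<eta> / h else 0)
             + (if j \<in> {Suc K..<n} then 3 * (a j / (real j)\<^sup>2) / h else 0))"
    proof (intro sum_mono)
      fix j assume j: "j \<in> {1..<m}"
      show "\<bar>A j\<bar> * (3 / ((real j)\<^sup>2 * h)) \<le> (if j \<in> {1..K} then 3 * \<eta> / h else 0)
             + (if j \<in> {Suc K..<n} then 3 * (a j / (real j)\<^sup>2) / h else 0)"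
      proof (cases "j \<le> K")
        case True
        have "\<bar>A j\<bar> * (3 / ((real j)\<^sup>2 * h)) \<le> (real j * \<eta>) * (3 / ((real j)\<^sup>2 * h))"
          using h by (intro mult_right_mono A2 True) auto
        also have "\<dots> = 3 * \<eta> / h * (1 / real j)" using j by (simp add: power2_eq_square mult_ac)
        also have "\<dots> \<le> 3 * \<eta> / h * 1" using j h \<eta>0 by (intro mult_left_mono) auto
        finally show ?thesis using j True by simp
      next
        case False
        have "\<bar>A j\<bar> * (3 / ((real j)\<^sup>2 * h)) \<le> a j * (3 / ((real j)\<^sup>2 * h))"
          using h j m by (intro mult_right_mono A1) auto
        then show ?thesis using j False m by (simp add: mult_ac)
      qed
    qed
    also have "\<dots> = (\<Sum>j=1..<m. (if j \<in> {1..K} then 3 * \<eta> / h else 0))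
             + (\<Sum>j=1..<m. (if j \<in> {Suc K..<n} then 3 * (a j / (real j)\<^sup>2) / h else 0))"
      by (rule sum.distrib)
    also have "(\<Sum>j=1..<m. (if j \<in> {1..K} then 3 * \<eta> / h else 0)) \<le> real K * (3 * \<eta> / h)"
    proof -
      have "(\<Sum>j=1..<m. (if j \<in> {1..K} then 3 * \<eta> / h else 0)) = real (card ({1..<m} \<inter> {1..K})) * (3 * \<eta> / h)"
        by (subst sum.inter_restrict[symmetric]) auto
      also have "\<dots> \<le> real K * (3 * \<eta> / h)"
        using card_mono[of "{1..K}" "{1..<m} \<inter> {1..K}"] h \<eta>0 by (intro mult_right_mono) auto
      finally show ?thesis .
    qed
    also have "(\<Sum>j=1..<m. (if j \<in> {Suc K..<n} then 3 * (a j / (real j)\<^sup>2) / h else 0))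
        \<le> (\<Sum>j=Suc K..<n. 3 * (a j / (real j)\<^sup>2) / h)"
      using h a0 by (subst sum.inter_restrict[symmetric]) (auto intro!: sum_mono2)
    finally have *: "\<bar>\<Sum>j=1..m. u j * v j\<bar> \<le> ?R / h"
      using h by (simp add: add_divide_distrib sum_distrib_left sum_divide_distrib algebra_simps)
    have "\<bar>\<Sum>j=1..m. ?G (t + real j * h)\<bar> = \<bar>sin (L * t)\<bar> * \<bar>\<Sum>j=1..m. u j * v j\<bar>"
      using G_eq by (simp add: sum_distrib_left abs_mult[symmetric])
    also have "\<dots> \<le> 1 * \<bar>\<Sum>j=1..m. u j * v j\<bar>"
      by (intro mult_right_mono) auto
    finally show ?thesis using * by simp
  qed
  have mid: "\<bar>integral {h..real n * h} ?G\<bar> \<le> ?R"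
  proof -
    have "norm (integral {0..h} (\<lambda>t. \<Sum>j=1..m. ?G (t + real j * h))) \<le> ?R / h * (h - 0)"
      using h pw by (intro integral_bound continuous_intros continuous_on_compose2[OF g]) auto
    also have "?R / h * (h - 0) = ?R" using h by simp
    finally show ?thesis
      using h integral_blocks[of ?G h m] G by (simp only: m(2)[symmetric] real_norm_def less_imp_le)
  qed
  have "integral {0..pi} ?G = integral {0..h} ?G + integral {h..real n * h} ?G + integral {real n * h..pi} ?G"
  proof -
    have "1 * h \<le> real n * h" using n h by (intro mult_right_mono) auto
    then show ?thesis
      using h nh Henstock_Kurzweil_Integration.integral_combine[of 0 h "real n * h" ?G]
        Henstock_Kurzweil_Integration.integral_combine[of 0 "real n * h" pi ?G] int by simp
  qed
  then have "\<bar>integral {0..pi} ?G\<bar>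
      \<le> \<bar>integral {0..h} ?G\<bar> + \<bar>integral {h..real n * h} ?G\<bar> + \<bar>integral {real n * h..pi} ?G\<bar>"
    by (simp only: abs_triangle_ineq order.trans[OF abs_triangle_ineq add_right_mono[OF abs_triangle_ineq]])
  also have "\<dots> \<le> pi * \<eta> + ?R + B * h"
    by (intro add_mono first mid last)
  finally show ?thesis by (simp only: m_def add_ac)
qed

section \<open>Uniform convergence\<close>

text \<open>The admissible families of \<open>var_sums\<close> with \<open>[0, 2 * pi]\<close>
  replaced by any \<open>[l, u]\<close>, so that they can be translated. Degenerate intervals are
  allowed, hence cutting a chain at a point again yields a chain.\<close>

definition interval_chain :: "nat \<Rightarrow> (nat \<Rightarrow> real) \<Rightarrow> (nat \<Rightarrow> real) \<Rightarrow> real \<Rightarrow> real \<Rightarrow> bool" where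
  "interval_chain n a b l u \<longleftrightarrow> (\<forall>j<n. l \<le> a j \<and> a j \<le> b j \<and> b j \<le> u) \<and>
     (\<forall>j. Suc j < n \<longrightarrow> b j \<le> a (Suc j))"

lemma periodic_2pi_of_int:
  assumes "periodic_2pi f"
  shows "f (x + 2 * pi * of_int m) = f x"
proof -
  interpret periodic_fun_simple f "2 * pi"
    by unfold_locales (use assms in \<open>simp add: periodic_2pi_def\<close>)
  show ?thesis using plus_of_int[of x m] by (simp add: mult_ac)
qed

lemma ex_int_shift:
  obtains m :: int where "c \<le> x + 2 * pi * of_int m" "x + 2 * pi * of_int m < c + 2 * pi"
proof -
  define k where "k = \<lfloor>(x - c) / (2 * pi)\<rfloor>"
  have "of_int k \<le> (x - c) / (2 * pi)" "(x - c) / (2 * pi) < of_int k + 1"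
    unfolding k_def by linarith+
  then have "of_int k * (2 * pi) \<le> x - c" "x - c < (of_int k + 1) * (2 * pi)"
    by (simp_all add: pos_le_divide_eq pos_divide_less_eq)
  then show ?thesis
    by (intro that[of "- k"]) (simp_all add: algebra_simps)
qed

text \<open>The argument for (ii) implies (i) needs only a bound \<open>\<mu>\<close> on sums of
  first powers; \<open>p\<close> and \<open>\<nu>\<close> enter later through the choice of
  \<open>\<mu>\<close>.\<close>

locale periodic_variation =
  fixes f :: "real \<Rightarrow> real" and \<mu> :: "nat \<Rightarrow> real" and B :: real
  assumes per: "periodic_2pi f"
    and bound: "\<And>x. \<bar>f x\<bar> \<le> B"
    and mono: "\<And>m n. m \<le> n \<Longrightarrow> \<mu> m \<le> \<mu> n"
    and var: "\<And>n a b. interval_chain n a b 0 (2 * pi) \<Longrightarrow> (\<Sum>j<n. \<bar>f (b j) - f (a j)\<bar>) \<le> \<mu> n"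
begin

text \<open>The chain is cut at the multiple \<open>P\<close> of \<open>2 * pi\<close> inside \<open>[z, z + 2 * pi]\<close>:
  \<open>f d - f c\<close> is the sum of the differences over \<open>min P\<close> and over \<open>max P\<close> of the endpoints.\<close>
lemma variation_shifted:
  assumes "interval_chain n a b z (z + 2 * pi)"
  shows "(\<Sum>j<n. \<bar>f (b j) - f (a j)\<bar>) \<le> 2 * \<mu> n"
proof -
  obtain m where m: "0 \<le> z + 2 * pi * of_int m" "z + 2 * pi * of_int m < 0 + 2 * pi"
    by (rule ex_int_shift)
  define s where "s = 2 * pi * of_int m"
  have fs: "f (x + s) = f x" "f (x + s - 2 * pi) = f x" for x
    using periodic_2pi_of_int[OF per, of x m] periodic_2pi_of_int[OF per, of x "m - 1"]
    by (auto simp: s_def algebra_simps)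
  let ?P = "2 * pi"
  define a1 b1 a2 b2 where "a1 = (\<lambda>j. min (a j + s) ?P)" and "b1 = (\<lambda>j. min (b j + s) ?P)"
    and "a2 = (\<lambda>j. max (a j + s) ?P - 2 * pi)" and "b2 = (\<lambda>j. max (b j + s) ?P - 2 * pi)"
  have ab: "0 \<le> a j + s" "a j \<le> b j" "b j + s \<le> 4 * pi" if "j < n" for j
    using assms m that unfolding interval_chain_def s_def by force+
  have ba: "b j \<le> a (Suc j)" if "Suc j < n" for j
    using assms that unfolding interval_chain_def by blast
  have c1: "interval_chain n a1 b1 0 (2 * pi)"
    unfolding interval_chain_def
  proof (intro conjI allI impI)
    fix j assume "j < n"
    from ab[OF this] show "0 \<le> a1 j" "a1 j \<le> b1 j" "b1 j \<le> 2 * pi"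
      by (auto simp: a1_def b1_def min_def)
  next
    fix j assume "Suc j < n"
    from ba[OF this] show "b1 j \<le> a1 (Suc j)"
      by (auto simp: a1_def b1_def min_def)
  qed
  have c2: "interval_chain n a2 b2 0 (2 * pi)"
    unfolding interval_chain_def
  proof (intro conjI allI impI)
    fix j assume "j < n"
    from ab[OF this] show "0 \<le> a2 j" "a2 j \<le> b2 j" "b2 j \<le> 2 * pi"
      by (auto simp: a2_def b2_def max_def)
  next
    fix j assume "Suc j < n"
    from ba[OF this] show "b2 j \<le> a2 (Suc j)"
      by (auto simp: a2_def b2_def max_def)
  qed
  have f2: "f (x - 2 * pi) = f x" for x
    using per unfolding periodic_2pi_def by (metis diff_add_cancel)
  \<comment> \<open>Of the first two terms one is \<open>f x\<close> and the other is
    \<open>f ?P\<close>, which the last term removes. In a difference of two such expressions the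
    constant cancels.\<close>
  have split: "f x = f (min (x + s) ?P) + f (max (x + s) ?P - 2 * pi) - f ?P" for x
    by (cases "x + s \<le> ?P") (simp_all only: min_absorb1 min_absorb2 max_absorb1 max_absorb2 f2 fs not_le less_imp_le)
  have "\<bar>f (b j) - f (a j)\<bar> \<le> \<bar>f (b1 j) - f (a1 j)\<bar> + \<bar>f (b2 j) - f (a2 j)\<bar>" for j
    unfolding a1_def b1_def a2_def b2_def using split[of "a j"] split[of "b j"] by linarith
  then have "(\<Sum>j<n. \<bar>f (b j) - f (a j)\<bar>)
      \<le> (\<Sum>j<n. \<bar>f (b1 j) - f (a1 j)\<bar>) + (\<Sum>j<n. \<bar>f (b2 j) - f (a2 j)\<bar>)"
    by (simp add: sum_mono flip: sum.distrib)
  then show ?thesis using var[OF c1] var[OF c2] by linarith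
qed

text \<open>Consecutive terms are paired into differences of \<open>f\<close> over
  \<open>k div 2\<close> nonoverlapping intervals inside \<open>[y, y + 2 * pi]\<close>; if
  \<open>k\<close> is odd, one unpaired value remains and is bounded by \<open>B\<close>.\<close>

lemma alternating_sum_bound:
  assumes h: "0 \<le> h" and kh: "real k * h \<le> 2 * pi"
  shows "\<bar>\<Sum>j=1..k. (-1) ^ j * f (y + real j * h)\<bar> \<le> 2 * \<mu> k + B"
proof -
  have B: "B \<ge> 0" using bound[of 0] by linarith
  define r where "r = k div 2"
  have even: "(\<Sum>j=1..2*r. (-1) ^ j * f (y + real j * h))
      = (\<Sum>i<r. f (y + real (2 * i + 2) * h) - f (y + real (2 * i + 1) * h))" for r
    by (induction r) auto
  have "interval_chain r (\<lambda>i. y + real (2 * i + 1) * h) (\<lambda>i. y + real (2 * i + 2) * h) y (y + 2 * pi)"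
  proof -
    have "real (2 * i + 2) * h \<le> 2 * pi" if "i < r" for i
    proof -
      have "real (2 * i + 2) * h \<le> real k * h"
        using that h by (intro mult_right_mono) (auto simp: r_def)
      then show ?thesis using kh by simp
    qed
    moreover have "0 \<le> real (2 * i + 1) * h" "real (2 * i + 1) * h \<le> real (2 * i + 2) * h"
      "real (2 * i + 2) * h \<le> real (2 * Suc i + 1) * h" for i
      using h by (auto intro!: mult_right_mono mult_nonneg_nonneg)
    ultimately show ?thesis
      unfolding interval_chain_def add_le_cancel_left le_add_same_cancel1 by blast
  qed
  then have "(\<Sum>i<r. \<bar>f (y + real (2 * i + 2) * h) - f (y + real (2 * i + 1) * h)\<bar>) \<le> 2 * \<mu> r"
    by (rule variation_shifted)
  also have "\<dots> \<le> 2 * \<mu> k" using mono[of r k] by (auto simp: r_def)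
  finally have *: "\<bar>\<Sum>j=1..2*r. (-1) ^ j * f (y + real j * h)\<bar> \<le> 2 * \<mu> k"
    unfolding even by (rule order.trans[OF sum_abs])
  consider "k = 2 * r" | "k = Suc (2 * r)" unfolding r_def by linarith
  then show ?thesis
  proof cases
    case 1
    then show ?thesis using * B by simp
  next
    case 2
    have "\<bar>\<Sum>j=1..k. (-1) ^ j * f (y + real j * h)\<bar>
        = \<bar>(\<Sum>j=1..2*r. (-1) ^ j * f (y + real j * h)) - f (y + real k * h)\<bar>"
      unfolding 2 by simp
    then show ?thesis using * bound[of "y + real k * h"] by linarith
  qed
qed

text \<open>Reversing the order of summation turns steps to the left from \<open>y\<close> into
  steps to the right from \<open>y - Suc k * h\<close>, up to a global sign.\<close>

lemma alternating_sum_bound_minus: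
  assumes h: "0 \<le> h" and kh: "real k * h \<le> 2 * pi"
  shows "\<bar>\<Sum>j=1..k. (-1) ^ j * f (y - real j * h)\<bar> \<le> 2 * \<mu> k + B"
proof -
  let ?y = "y - real (Suc k) * h"
  have "(\<Sum>j=1..k. (-1) ^ j * f (y - real j * h))
      = (\<Sum>j=1..k. (-1) ^ (k + 1 - j) * f (y - real (k + 1 - j) * h))"
    by (rule sum.atLeastAtMost_rev)
  also have "\<dots> = (\<Sum>j=1..k. (-1) ^ Suc k * ((-1) ^ j * f (?y + real j * h)))"
  proof (intro sum.cong refl)
    fix j assume j: "j \<in> {1..k}"
    have "(-1) ^ (k + 1 - j) * (-1) ^ j = ((-1) ^ Suc k :: real)"
      using j by (simp flip: power_add)
    then have "(-1) ^ (k + 1 - j) = (-1) ^ Suc k * ((-1) ^ j :: real)"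
      by (metis minus_one_mult_self mult.assoc mult.right_neutral)
    then show "(-1) ^ (k + 1 - j) * f (y - real (k + 1 - j) * h)
        = (-1) ^ Suc k * ((-1) ^ j * f (?y + real j * h))"
      using j by (simp add: of_nat_diff algebra_simps)
  qed
  also have "\<dots> = (-1) ^ Suc k * (\<Sum>j=1..k. (-1) ^ j * f (?y + real j * h))"
    by (simp only: sum_distrib_left)
  finally show ?thesis
    using alternating_sum_bound[OF assms, of ?y] by (simp add: abs_mult)
qed

lemma abs_alternating_const: "\<bar>\<Sum>j=1..k. (-1) ^ j * c\<bar> \<le> \<bar>c :: real\<bar>"
proof -
  have "(\<Sum>j=1..k. (-1) ^ j * c) = (if even k then 0 else - c)"
    by (induction k) auto
  then show ?thesis by simp
qed

text \<open>\<open>dirichlet_integral_bound\<close> is applied to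
  \<open>g t = f (x + t) + f (x - t) - 2 * f x\<close>. First \<open>K\<close> is fixed from the
  tail of the series, then \<open>\<eta>\<close> from \<open>K\<close>, then \<open>n\<close> is
  taken large; none of the choices depends on \<open>x\<close> in \<open>[pi, 3 * pi]\<close>, and
  periodicity covers the other points.\<close>

lemma fourier_uniform_limit:
  assumes f: "continuous_on UNIV f"
    and sum: "summable (\<lambda>j. \<mu> j / (real j)\<^sup>2)"
    and lim: "(\<lambda>j. \<mu> j / real j) \<longlonglongrightarrow> 0"
  shows "uniform_limit UNIV (fourier_partial_sum f) f sequentially"
proof -
  \<comment> \<open>The two translates of \<open>f\<close> contribute \<open>2 * \<mu> j + B\<close>
    each, the constant \<open>2 * f x\<close> contributes at most \<open>2 * B\<close>, and the sum
    is rounded up by \<open>\<mu>\<close>-free slack nowhere: the total is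
    \<open>4 * \<mu> j + 4 * B\<close>.\<close>
  define a where "a j = 4 * \<mu> j + 4 * B" for j
  have B: "B \<ge> 0" using bound[of 0] by linarith
  have "summable (\<lambda>j. 4 * (\<mu> j / (real j)\<^sup>2) + 4 * B * (1 / (real j)\<^sup>2))"
    using sum inverse_squares_sums by (intro summable_add summable_mult)
      (auto simp: sums_iff summable_Suc_iff[of "\<lambda>j. 1 / (real j)\<^sup>2", symmetric] add.commute)
  then have a_sum: "summable (\<lambda>j. a j / (real j)\<^sup>2)"
    by (simp add: a_def add_divide_distrib)
  have "(\<lambda>j. 4 * (\<mu> j / real j) + 4 * B * (1 / real j)) \<longlonglongrightarrow> 4 * 0 + 4 * B * 0"
    by (intro tendsto_add tendsto_mult tendsto_const lim lim_const_over_n)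
  then have a_lim: "(\<lambda>j. a j / real j) \<longlonglongrightarrow> 0"
    by (simp add: a_def add_divide_distrib)
  have ct: "continuous_on A (\<lambda>t. f (g t))" if "continuous_on A g" for A and g :: "real \<Rightarrow> real"
    using continuous_on_compose2[OF f that] by auto
  have main: "\<exists>N. \<forall>n\<ge>N. \<forall>x\<in>{pi..3 * pi}. \<bar>fourier_partial_sum f n x - f x\<bar> < e" if e: "e > 0" for e
  proof -
    obtain K where K: "\<And>m n. m \<ge> K \<Longrightarrow> norm (\<Sum>j=m..<n. a j / (real j)\<^sup>2) < e / 12"
      using a_sum[unfolded summable_Cauchy, rule_format, of "e / 12"] e by auto
    \<comment> \<open>Chosen so that the terms \<open>pi * \<eta>\<close> and
      \<open>3 * K * \<eta>\<close> together use at most a quarter of \<open>e\<close>.\<close>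
    define \<eta> where "\<eta> = e / (4 * (4 + 3 * real K))"
    have \<eta>: "\<eta> > 0" using e by (simp add: \<eta>_def add_pos_nonneg)
    have \<eta>_eq: "(4 + 3 * real K) * \<eta> = e / 4"
      by (simp add: \<eta>_def add_pos_nonneg field_simps)
    \<comment> \<open>This interval contains \<open>x + t\<close> and \<open>x - t\<close> for all
      \<open>x\<close> in \<open>[pi, 3 * pi]\<close> and \<open>0 \<le> t \<le> pi\<close>.\<close>
    have "uniformly_continuous_on {0..4 * pi} f"
      by (intro compact_uniformly_continuous continuous_on_subset[OF f]) auto
    then obtain \<delta> where \<delta>: "\<delta> > 0" "\<And>x y. x \<in> {0..4 * pi} \<Longrightarrow> y \<in> {0..4 * pi} \<Longrightarrow> dist y x < \<delta> \<Longrightarrow> dist (f y) (f x) < \<eta> / 2"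
      using \<eta> unfolding uniformly_continuous_on_def by (metis half_gt_zero)
    have h_lim: "(\<lambda>n. pi / (real n + 1 / 2)) \<longlonglongrightarrow> 0"
    proof (rule tendsto_sandwich[OF _ _ tendsto_const lim_const_over_n[of pi]])
      have "pi / (real n + 1 / 2) \<le> pi / real n" if "n \<ge> 1" for n
        using that by (intro divide_left_mono mult_pos_pos) auto
      then show "\<forall>\<^sub>F n in sequentially. pi / (real n + 1 / 2) \<le> pi / real n"
        unfolding eventually_sequentially by (intro exI[of _ 1]) auto
    qed (auto intro!: divide_nonneg_nonneg add_nonneg_nonneg)
    have ev: "\<forall>\<^sub>F n in sequentially. 2 \<le> n \<and> real (Suc K) * (pi / (real n + 1 / 2)) < min \<delta> pi
        \<and> 4 * B * (pi / (real n + 1 / 2)) < e / 4 \<and> a (n - 1) / real (n - 1) < e / 8"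
    proof (intro eventually_conj eventually_ge_at_top)
      show "\<forall>\<^sub>F n in sequentially. real (Suc K) * (pi / (real n + 1 / 2)) < min \<delta> pi"
        using \<delta>(1) by (intro order_tendstoD(2)[OF tendsto_mult_right_zero[OF h_lim]]) auto
      show "\<forall>\<^sub>F n in sequentially. 4 * B * (pi / (real n + 1 / 2)) < e / 4"
        using e by (intro order_tendstoD(2)[OF tendsto_mult_right_zero[OF h_lim]]) auto
      have "\<forall>\<^sub>F n in sequentially. a n / real n < e / 8"
        using e by (intro order_tendstoD(2)[OF a_lim]) auto
      then obtain N where N: "\<And>n. n \<ge> N \<Longrightarrow> a n / real n < e / 8"
        by (auto simp: eventually_sequentially)
      have "a (n - 1) / real (n - 1) < e / 8" if "n \<ge> Suc N" for n
        by (rule N) (use that in auto)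
      then show "\<forall>\<^sub>F n in sequentially. a (n - 1) / real (n - 1) < e / 8"
        unfolding eventually_sequentially by (intro exI[of _ "Suc N"] allI impI)
    qed
    have "\<bar>fourier_partial_sum f n x - f x\<bar> < e"
      if n: "2 \<le> n" and n1: "real (Suc K) * (pi / (real n + 1 / 2)) < min \<delta> pi"
        and n2: "4 * B * (pi / (real n + 1 / 2)) < e / 4" and n3: "a (n - 1) / real (n - 1) < e / 8"
        and x: "pi \<le> x" "x \<le> 3 * pi" for n x
    proof -
      let ?h = "pi / (real n + 1 / 2)"
      define g where "g t = f (x + t) + f (x - t) - 2 * f x" for t
      have h: "?h > 0" by (simp add: add_pos_nonneg)
      have "\<bar>integral {0..pi} (\<lambda>t. g t * dirichlet n t)\<bar>
          \<le> pi * \<eta> + (4 * B) * ?h + (3 * (real K * \<eta> + (\<Sum>j=Suc K..<n. a j / (real j)\<^sup>2))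
            + 2 * a (n - 1) / real (n - 1))"
      proof (rule dirichlet_integral_bound[OF n])
        show "continuous_on UNIV g"
          unfolding g_def by (intro continuous_intros ct)
        show "\<bar>g t\<bar> \<le> 4 * B" for t
          using bound[of "x + t"] bound[of "x - t"] bound[of x] unfolding g_def by linarith
        show "\<bar>g t\<bar> \<le> \<eta>" if t: "0 \<le> t" "t \<le> real (Suc K) * ?h" for t
        proof -
          have "t < \<delta>" "t < pi" using t n1 by auto
          then have "dist (f (x + t)) (f x) < \<eta> / 2" "dist (f (x - t)) (f x) < \<eta> / 2"
            using x t(1) \<delta>(2)[of x "x + t"] \<delta>(2)[of x "x - t"] by (auto simp: dist_real_def)
          then show ?thesis unfolding g_def dist_real_def by linarith
        qed
        show "\<bar>\<Sum>j=1..k. (-1) ^ j * g (t + real j * ?h)\<bar> \<le> a k" if "k < n" for t k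
        proof -
          have kh: "real k * ?h \<le> 2 * pi"
          proof -
            have "real k * pi \<le> real n * pi" using that by (intro mult_right_mono) auto
            moreover have "0 \<le> real n * pi" by simp
            moreover have "2 * pi * (real n + 1 / 2) = 2 * (real n * pi) + pi"
              by (simp add: algebra_simps)
            ultimately have "real k * pi \<le> 2 * pi * (real n + 1 / 2)"
              using pi_gt_zero by linarith
            then show ?thesis by (simp add: pos_divide_le_eq add_pos_nonneg)
          qed
          have "(\<Sum>j=1..k. (-1) ^ j * g (t + real j * ?h))
            = (\<Sum>j=1..k. (-1) ^ j * f ((x + t) + real j * ?h))
              + (\<Sum>j=1..k. (-1) ^ j * f ((x - t) - real j * ?h))
              - (\<Sum>j=1..k. (-1) ^ j * (2 * f x))"
            unfolding g_def by (simp add: sum.distrib sum_subtractf algebra_simps)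
          then show ?thesis
            using alternating_sum_bound[OF less_imp_le[OF h] kh, of "x + t"]
              alternating_sum_bound_minus[OF less_imp_le[OF h] kh, of "x - t"]
              abs_alternating_const[of "2 * f x" k] bound[of x]
            unfolding a_def by linarith
        qed
      qed
      also have "\<dots> < e"
      proof -
        \<comment> \<open>Four quarters of \<open>e\<close>: the \<open>\<eta>\<close> terms,
          \<open>4 * B * h\<close>, three times the tail \<open>e / 12\<close>, and twice the
          boundary term \<open>e / 8\<close>.\<close>
        have arith: "b1 + b2 + (3 * (b3 + b4) + 2 * b5 / b6) < e"
          if "b4 < e / 12" "b1 \<le> 4 * \<eta>" "4 * \<eta> + 3 * b3 = e / 4" "b2 < e / 4" "b5 / b6 < e / 8"
          for b1 b2 b3 b4 b5 b6 :: real
          using that by (simp only: distrib_left times_divide_eq_right[symmetric])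
        have "(\<Sum>j=Suc K..<n. a j / (real j)\<^sup>2) < e / 12"
          using K[of "Suc K" n] by simp
        moreover have "pi * \<eta> \<le> 4 * \<eta>" using \<eta> pi_less_4 by simp
        moreover have "4 * \<eta> + 3 * (real K * \<eta>) = e / 4"
          using \<eta>_eq by (simp add: algebra_simps)
        ultimately show ?thesis by (rule arith[OF _ _ _ n2 n3])
      qed
      finally have "\<bar>integral {0..pi} (\<lambda>t. g t * dirichlet n t)\<bar> < e" .
      also have "e \<le> pi * e" using e pi_gt3 by simp
      finally show ?thesis
        unfolding fourier_partial_sum_diff[OF f per x] g_def[symmetric]
        by (simp add: abs_mult field_simps)
    qed
    note * = this
    from ev obtain N where N: "\<And>n. n \<ge> N \<Longrightarrow> 2 \<le> n \<and> real (Suc K) * (pi / (real n + 1 / 2)) < min \<delta> pi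
        \<and> 4 * B * (pi / (real n + 1 / 2)) < e / 4 \<and> a (n - 1) / real (n - 1) < e / 8"
      unfolding eventually_sequentially by blast
    show ?thesis
    proof (intro exI[of _ N] allI impI ballI)
      fix n x assume nx: "N \<le> n" "x \<in> {pi..3 * pi}"
      show "\<bar>fourier_partial_sum f n x - f x\<bar> < e"
        using N[OF nx(1)] nx(2) by (intro *) auto
    qed
  qed
  show ?thesis
    unfolding uniform_limit_iff eventually_sequentially
  proof (intro allI impI)
    fix e :: real assume "e > 0"
    from main[OF this] obtain N where
      N: "\<And>n x. n \<ge> N \<Longrightarrow> x \<in> {pi..3 * pi} \<Longrightarrow> \<bar>fourier_partial_sum f n x - f x\<bar> < e" by blast
    have "dist (fourier_partial_sum f n x) (f x) < e" if "n \<ge> N" for n x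
    proof -
      obtain m where m: "pi \<le> x + 2 * pi * of_int m" "x + 2 * pi * of_int m < pi + 2 * pi"
        by (rule ex_int_shift)
      have "periodic_2pi (fourier_partial_sum f n)"
      proof -
        have "dirichlet n (t - (x + 2 * pi)) = dirichlet n (t - x)" for t x
          using dirichlet_periodic[of n "t - (x + 2 * pi)"] by (simp add: algebra_simps)
        then show ?thesis
          by (simp add: periodic_2pi_def fourier_partial_sum_eq_dirichlet[OF f])
      qed
      then show ?thesis
        using N[OF that, of "x + 2 * pi * of_int m"] m
        by (simp add: periodic_2pi_of_int periodic_2pi_of_int[OF per] dist_real_def)
    qed
    then show "\<exists>N. \<forall>n\<ge>N. \<forall>x\<in>UNIV. dist (fourier_partial_sum f n x) (f x) < e" by blast
  qed
qed

end

section \<open>Passage from \<open>p\<close>-th powers to first powers\<close>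

text \<open>Jensen's inequality for \<open>x powr p\<close>, applied to the positive terms alone;
  there are at most \<open>n\<close> of them and the factor in front grows with their
  number.\<close>

lemma sum_le_powr_mean:
  fixes x :: "nat \<Rightarrow> real"
  assumes p: "1 \<le> p" and x: "\<And>j. j < n \<Longrightarrow> 0 \<le> x j"
  shows "(\<Sum>j<n. x j) \<le> real n powr (1 - 1 / p) * (\<Sum>j<n. x j powr p) powr (1 / p)"
proof -
  define S where "S = {j. j < n \<and> x j > 0}"
  let ?c = "real (card S)" and ?s = "\<Sum>j\<in>S. x j"
  have S: "finite S" "S \<subseteq> {..<n}" by (auto simp: S_def)
  have sum_S: "(\<Sum>j<n. g (x j)) = (\<Sum>j\<in>S. g (x j))" if "g 0 = 0" for g :: "real \<Rightarrow> real"
  proof (rule sum.mono_neutral_right)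
    show "\<forall>i\<in>{..<n} - S. g (x i) = 0"
    proof
      fix i assume "i \<in> {..<n} - S"
      then have "x i = 0" using x[of i] by (auto simp: S_def)
      then show "g (x i) = 0" using that by simp
    qed
  qed (use S in auto)
  show ?thesis
  proof (cases "S = {}")
    case True
    then show ?thesis using sum_S[of "\<lambda>x. x"] by simp
  next
    case False
    then have c: "?c > 0" using S by (simp add: card_gt_0_iff)
    have s0: "?s \<ge> 0" by (intro sum_nonneg) (auto simp: S_def)
    have "(\<Sum>j\<in>S. (1 / ?c) *\<^sub>R x j) powr p \<le> (\<Sum>j\<in>S. (1 / ?c) * x j powr p)"
      using c False S by (intro convex_on_sum[OF _ _ powr_convex[OF p]]) (auto simp: S_def)
    then have "(?s / ?c) powr p \<le> (\<Sum>j\<in>S. x j powr p) / ?c"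
      by (simp add: sum_divide_distrib)
    then have "((?s / ?c) powr p) powr (1 / p) \<le> ((\<Sum>j\<in>S. x j powr p) / ?c) powr (1 / p)"
      by (rule powr_mono2[rotated 2]) (use p in auto)
    then have "?s / ?c \<le> (\<Sum>j\<in>S. x j powr p) powr (1 / p) / ?c powr (1 / p)"
      using p s0 c by (simp add: powr_powr powr_divide sum_nonneg)
    then have "?s \<le> ?c powr (1 - 1 / p) * (\<Sum>j\<in>S. x j powr p) powr (1 / p)"
      using c by (simp add: powr_diff field_simps)
    also have "\<dots> \<le> real n powr (1 - 1 / p) * (\<Sum>j\<in>S. x j powr p) powr (1 / p)"
    proof (intro mult_right_mono powr_mono2)
      show "?c \<le> real n" using card_mono[OF _ S(2)] by simp
    qed (use p in auto)
    finally show ?thesis using sum_S[of "\<lambda>x. x"] sum_S[of "\<lambda>x. x powr p"] by simp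
  qed
qed

text \<open>Needed so that the real-valued \<open>Sup\<close> in \<open>upsilon_p\<close> really
  dominates the individual sums.\<close>

lemma bdd_above_var_sums:
  assumes p: "1 \<le> p" and B: "\<And>x. \<bar>f x\<bar> \<le> B"
  shows "bdd_above (var_sums p n f)"
proof (rule bdd_aboveI)
  fix v assume "v \<in> var_sums p n f"
  then obtain a b where v: "v = (\<Sum>j<n. \<bar>f (b j) - f (a j)\<bar> powr p) powr (1 / p)"
    by (auto simp: var_sums_def)
  have "\<bar>f x - f y\<bar> \<le> 2 * B" for x y using B[of x] B[of y] by linarith
  then have "(\<Sum>j<n. \<bar>f (b j) - f (a j)\<bar> powr p) \<le> (\<Sum>j<n. (2 * B) powr p)"
    using p by (intro sum_mono powr_mono2) auto
  then show "v \<le> (\<Sum>j<n. (2 * B) powr p) powr (1 / p)"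
    unfolding v using p by (intro powr_mono2[of "1 / p"]) (auto intro: sum_nonneg)
qed

context modulus
begin

lemma Vp_fourier_uniform_limit:
  assumes sum: "summable (\<lambda>k. \<nu> (Suc k) * real (Suc k) powr (-(1 + 1 / p)))"
    and f: "f \<in> Vp p \<nu>" "continuous_on UNIV f"
  shows "uniform_limit UNIV (fourier_partial_sum f) f sequentially"
proof -
  obtain B where B: "\<And>x. \<bar>f x\<bar> \<le> B"
    using f(1) by (auto simp: Vp_def bounded_iff)
  obtain C where C: "\<And>n. n \<ge> 1 \<Longrightarrow> upsilon_p p n f \<le> C * \<nu> n"
    using f(1) by (auto simp: Vp_def)
  \<comment> \<open>With this \<open>\<mu>\<close>, \<open>\<mu> k / k\<close> is
    \<open>\<bar>C\<bar> * \<nu> k / k powr (1 / p)\<close> and \<open>\<mu> k / k\<^sup>2\<close>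
    is \<open>\<bar>C\<bar>\<close> times the term of (ii). The absolute value keeps
    \<open>\<mu>\<close> monotone whatever the sign of \<open>C\<close>.\<close>
  define \<mu> where "\<mu> n = real n powr (1 - 1 / p) * (\<bar>C\<bar> * \<nu> n)" for n
  have p1: "1 / p \<le> 1" using p by simp
  interpret periodic_variation f \<mu> B
  proof
    show "periodic_2pi f" using f(1) by (simp add: Vp_def)
    show "\<mu> m \<le> \<mu> n" if "m \<le> n" for m n
      unfolding \<mu>_def using that p1 by (intro mult_mono powr_mono2 nu_mono) auto
    fix n a b assume ch: "interval_chain n a b 0 (2 * pi)"
    show "(\<Sum>j<n. \<bar>f (b j) - f (a j)\<bar>) \<le> \<mu> n"
    proof (cases "n = 0")
      case False
      have "(\<Sum>j<n. \<bar>f (b j) - f (a j)\<bar> powr p) powr (1 / p) \<in> var_sums p n f"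
        using ch unfolding var_sums_def interval_chain_def by blast
      then have "(\<Sum>j<n. \<bar>f (b j) - f (a j)\<bar> powr p) powr (1 / p) \<le> upsilon_p p n f"
        unfolding upsilon_p_def by (intro cSup_upper bdd_above_var_sums[OF p B])
      also have "\<dots> \<le> C * \<nu> n" using False by (intro C) auto
      also have "\<dots> \<le> \<bar>C\<bar> * \<nu> n" by (intro mult_right_mono) auto
      finally have "real n powr (1 - 1 / p) * (\<Sum>j<n. \<bar>f (b j) - f (a j)\<bar> powr p) powr (1 / p) \<le> \<mu> n"
        unfolding \<mu>_def by (intro mult_left_mono) auto
      then show ?thesis
        using sum_le_powr_mean[OF p, of n "\<lambda>j. \<bar>f (b j) - f (a j)\<bar>"] by simp
    qed (simp add: \<mu>_def)
  qed (rule B)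
  show ?thesis
  proof (rule fourier_uniform_limit[OF f(2)])
    have e: "\<mu> k / real k = \<bar>C\<bar> * (\<nu> k / real k powr (1 / p))" for k
      by (cases "k = 0") (simp_all add: \<mu>_def powr_diff)
    show "(\<lambda>j. \<mu> j / real j) \<longlonglongrightarrow> 0"
      unfolding e by (rule tendsto_mult_right_zero[OF lim0])
    have "\<mu> (Suc k) / (real (Suc k))\<^sup>2 = \<bar>C\<bar> * (\<nu> (Suc k) * real (Suc k) powr (-(1 + 1 / p)))" for k
      unfolding power2_eq_square divide_divide_eq_left[symmetric] e
      by (simp only: minus_add_distrib powr_add powr_minus powr_one_gt_zero_iff powr_one divide_inverse
          of_nat_0_le_iff mult_ac)
    then have "summable (\<lambda>k. \<mu> (Suc k) / (real (Suc k))\<^sup>2)"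
      using summable_mult[OF sum, of "\<bar>C\<bar>"] by simp
    then show "summable (\<lambda>j. \<mu> j / (real j)\<^sup>2)"
      by (subst (asm) summable_Suc_iff)
  qed
qed

end

section \<open>A divergent Fourier series\<close>

lemma sum_powr_le_powr_sum:
  fixes x :: "'a \<Rightarrow> real"
  assumes "1 \<le> p" "finite A" and x: "\<And>j. j \<in> A \<Longrightarrow> 0 \<le> x j"
  shows "(\<Sum>j\<in>A. x j powr p) \<le> (\<Sum>j\<in>A. x j) powr p"
proof -
  let ?X = "\<Sum>j\<in>A. x j"
  have X: "?X \<ge> 0" using x by (rule sum_nonneg)
  have "(\<Sum>j\<in>A. x j powr p) \<le> (\<Sum>j\<in>A. x j * ?X powr (p - 1))"
  proof (rule sum_mono)
    fix j assume j: "j \<in> A"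
    have "x j powr p = x j * x j powr (p - 1)" using x[OF j] by (simp add: powr_mult_base)
    also have "\<dots> \<le> x j * ?X powr (p - 1)"
      using assms x[OF j] member_le_sum[OF j, of x] x j by (intro mult_left_mono powr_mono2) auto
    finally show "x j powr p \<le> x j * ?X powr (p - 1)" .
  qed
  also have "\<dots> = ?X powr p"
    using X by (simp add: powr_mult_base flip: sum_distrib_right)
  finally show ?thesis .
qed

text \<open>The increments of a monotone \<open>m\<close> over the gaps of the chain are
  nonnegative, so adding them gives a telescoping upper bound.\<close>

lemma sum_chain_mono_le:
  fixes m :: "real \<Rightarrow> real"
  assumes m: "\<And>x y. l \<le> x \<Longrightarrow> x \<le> y \<Longrightarrow> y \<le> u \<Longrightarrow> m x \<le> m y"
    and a: "\<And>j. j < n \<Longrightarrow> l \<le> a j \<and> a j \<le> b j \<and> b j \<le> u"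
    and b: "\<And>j. Suc j < n \<Longrightarrow> b j \<le> a (Suc j)"
    and lu: "l \<le> u"
  shows "(\<Sum>j<n. m (b j) - m (a j)) \<le> m u - m l"
proof (cases n)
  case 0
  then show ?thesis using m[of l u] lu by simp
next
  case (Suc k)
  have "i \<le> k \<Longrightarrow> (\<Sum>j<Suc i. m (b j) - m (a j)) \<le> m (b i) - m l" for i
  proof (induction i)
    case 0
    then show ?case using m[of l "a 0"] a[of 0] Suc by simp
  next
    case (Suc i)
    then have "m (b i) \<le> m (a (Suc i))"
      using a[of i] a[of "Suc i"] b[of i] \<open>n = Suc k\<close> by (intro m) auto
    then show ?case using Suc by simp
  qed
  from this[of k] show ?thesis
    using m[of "b k" u] a[of k] Suc by (force intro: order.trans)
qed

section \<open>Functions built from disjoint half sine waves\<close>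

text \<open>Bump \<open>k\<close> is the half wave of \<open>sin (L k * t)\<close> on
  \<open>[2 * k * pi / L k, (2 * k + 1) * pi / L k]\<close>, where that sine is nonnegative.
  \<open>L_ge\<close> keeps the interval inside \<open>[0, pi]\<close>. Index \<open>0\<close> is
  neutralized by \<open>e 0 = 0\<close>.\<close>

locale bumps =
  fixes e L :: "nat \<Rightarrow> real" and E :: real
  assumes e_0: "e 0 = 0" and e_nonneg: "\<And>k. 0 \<le> e k" and e_le: "\<And>k. e k \<le> E"
    and e_lim: "e \<longlonglongrightarrow> 0"
    and L_ge: "\<And>k. 1 \<le> k \<Longrightarrow> real (2 * k + 1) \<le> L k"
    and disjoint: "\<And>k l. 1 \<le> k \<Longrightarrow> 1 \<le> l \<Longrightarrow> k \<noteq> l \<Longrightarrow>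
       real (2 * k + 1) * pi / L k \<le> real (2 * l) * pi / L l \<or>
       real (2 * l + 1) * pi / L l \<le> real (2 * k) * pi / L k"
begin

definition lo where "lo k = real (2 * k) * pi / L k"
definition hi where "hi k = real (2 * k + 1) * pi / L k"
text \<open>Evaluating the sine at the clamped argument makes a bump vanish off its interval, both
  endpoints being zeros of the sine. Continuity needs no case distinction, and the variation of a
  bump is controlled by that of a monotone function.\<close>

definition clamp where "clamp k t = max (lo k) (min (hi k) t)"
definition bump where "bump k t = e k * sin (L k * clamp k t)"
definition F where "F t = (\<Sum>k. bump k t)"

lemma E_nonneg: "E \<ge> 0"
  using e_nonneg[of 0] e_le[of 0] by linarith

lemma L_pos: "1 \<le> k \<Longrightarrow> L k > 0"
  using L_ge[of k] by simp

lemma lo_hi: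
  assumes "1 \<le> k"
  shows "0 < lo k" "lo k < hi k" "hi k \<le> pi" "hi k - lo k = pi / L k"
    "L k * lo k = real (2 * k) * pi" "L k * hi k = real (2 * k + 1) * pi"
  using assms L_pos[OF assms] L_ge[OF assms] unfolding lo_def hi_def
  by (auto simp: divide_less_cancel pos_divide_le_eq mult.commute[of pi] mult_right_mono
      simp flip: diff_divide_distrib left_diff_distrib)

lemma clamp_bounds: "1 \<le> k \<Longrightarrow> lo k \<le> clamp k t \<and> clamp k t \<le> hi k"
  using lo_hi(2)[of k] by (auto simp: clamp_def)

lemma clamp_mono: "s \<le> t \<Longrightarrow> clamp k s \<le> clamp k t"
  by (auto simp: clamp_def intro!: max.mono min.mono)

lemma bump_0 [simp]: "bump 0 t = 0"
  by (simp add: bump_def e_0)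

lemma bump_bounds: "0 \<le> bump k t \<and> bump k t \<le> e k"
proof (cases "k = 0")
  case False
  then have k: "1 \<le> k" by simp
  let ?c = "clamp k t"
  have "real (2 * k) * pi \<le> L k * ?c" "L k * ?c \<le> real (2 * k + 1) * pi"
    using clamp_bounds[OF k, of t] L_pos[OF k] unfolding lo_hi(5,6)[OF k, symmetric]
    by (auto intro: mult_left_mono)
  then have "0 \<le> sin (L k * ?c - real (2 * k) * pi)"
    by (intro sin_ge_zero) (auto simp: algebra_simps)
  then have "0 \<le> sin (L k * ?c)" by (simp add: sin_diff cos_npi sin_npi)
  then show ?thesis
    using e_nonneg[of k] by (auto simp: bump_def intro: mult_left_le)
qed (simp add: e_nonneg)

lemma bump_outside:
  assumes "t \<le> lo k \<or> hi k \<le> t"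
  shows "bump k t = 0"
proof (cases "k = 0")
  case False
  then have k: "1 \<le> k" by simp
  then have "clamp k t = lo k \<or> clamp k t = hi k"
    using assms lo_hi(2)[OF k] by (auto simp: clamp_def)
  then show ?thesis
    by (elim disjE) (simp_all only: bump_def lo_hi(5,6)[OF k] sin_npi mult_zero_right)
qed simp

lemma bump_inside: "t \<in> {lo k..hi k} \<Longrightarrow> bump k t = e k * sin (L k * t)"
  by (simp add: bump_def clamp_def)

lemma bump_nonzero_unique:
  assumes "bump k t \<noteq> 0" "bump l t \<noteq> 0"
  shows "k = l"
proof (rule ccontr)
  assume "k \<noteq> l"
  moreover have "k \<noteq> 0" "l \<noteq> 0" using assms bump_0 by metis+
  then have "1 \<le> k" "1 \<le> l" by simp_all
  ultimately have "hi k \<le> lo l \<or> hi l \<le> lo k"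
    using disjoint unfolding lo_def hi_def by blast
  moreover have "lo k < t" "t < hi k" "lo l < t" "t < hi l"
    using assms bump_outside[of t] by (meson not_le)+
  ultimately show False by linarith
qed

lemma F_cases:
  obtains k where "F t = bump k t" "\<And>l. l \<noteq> k \<Longrightarrow> bump l t = 0"
proof -
  obtain k where k: "\<And>l. l \<noteq> k \<Longrightarrow> bump l t = 0"
    using bump_nonzero_unique by blast
  then have "F t = bump k t"
    unfolding F_def using suminf_finite[of "{k}" "\<lambda>k. bump k t"] by auto
  with k show ?thesis by (intro that)
qed

lemma F_diff_sum:
  assumes "finite A"
  obtains k where "F t - (\<Sum>k\<in>A. bump k t) = (if k \<in> A then 0 else bump k t)"
proof -
  obtain k where k: "F t = bump k t" "\<And>l. l \<noteq> k \<Longrightarrow> bump l t = 0"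
    using F_cases[of t] by metis
  have "(\<Sum>k\<in>A. bump k t) = (\<Sum>l\<in>A. if l = k then bump k t else 0)"
    using k(2) by (intro sum.cong) auto
  then have "F t - (\<Sum>k\<in>A. bump k t) = (if k \<in> A then 0 else bump k t)"
    using assms k(1) by simp
  then show ?thesis by (rule that)
qed

lemma continuous_bump: "continuous_on A (bump k)"
  unfolding bump_def clamp_def by (intro continuous_intros)

text \<open>Supports do not overlap, so the error of a partial sum at any point is at most one bump
  of large index, hence uniformly small since \<open>e\<close> tends to \<open>0\<close>.\<close>

lemma continuous_F: "continuous_on UNIV F"
proof (rule uniform_limit_theorem)
  show "uniform_limit UNIV (\<lambda>n t. \<Sum>k<n. bump k t) F sequentially"
    unfolding uniform_limit_iff
  proof (intro allI impI)
    fix r :: real assume r: "r > 0"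
    then obtain N where N: "\<And>k. k \<ge> N \<Longrightarrow> e k < r"
      using order_tendstoD(2)[OF e_lim, of r] by (auto simp: eventually_sequentially)
    have "dist (\<Sum>k<n. bump k t) (F t) < r" if n: "n \<ge> N" for n t
    proof -
      obtain k where k: "F t - (\<Sum>k<n. bump k t) = (if k \<in> {..<n} then 0 else bump k t)"
        by (rule F_diff_sum[of "{..<n}"]) auto
      show ?thesis
        using k N[of k] n r bump_bounds[of k t] by (auto simp: dist_real_def split: if_splits)
    qed
    then show "\<forall>\<^sub>F n in sequentially. \<forall>t\<in>UNIV. dist (\<Sum>k<n. bump k t) (F t) < r"
      unfolding eventually_sequentially by blast
  qed
qed (auto intro!: always_eventually continuous_on_sum continuous_bump)

lemma bump_lipschitz: "\<bar>bump k t - bump k s\<bar> \<le> e k * L k * \<bar>clamp k t - clamp k s\<bar>"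
proof (cases "k = 0")
  case False
  have "\<bar>bump k t - bump k s\<bar> = e k * \<bar>sin (L k * clamp k t) - sin (L k * clamp k s)\<bar>"
    using e_nonneg[of k] by (simp add: bump_def abs_mult flip: right_diff_distrib)
  also have "\<dots> \<le> e k * \<bar>L k * clamp k t - L k * clamp k s\<bar>"
    by (intro mult_left_mono abs_sin_diff_le e_nonneg)
  finally show ?thesis
    using L_pos[of k] False by (simp add: abs_mult flip: right_diff_distrib)
qed (simp add: e_0)

text \<open>\<open>arccos \<circ> cos\<close> is the even \<open>2 * pi\<close>-periodic continuation of the identity on \<open>[0, pi]\<close>.\<close>
definition f where "f t = F (arccos (cos t))"

lemma f_continuous: "continuous_on UNIV f"
  unfolding f_def
  by (rule continuous_on_compose2[OF continuous_F], rule continuous_on_compose2[OF continuous_on_arccos'])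
     (auto intro!: continuous_intros)

lemma f_periodic: "periodic_2pi f"
  by (simp add: periodic_2pi_def f_def)

lemma f_2pi: "0 \<le> t \<Longrightarrow> t \<le> pi \<Longrightarrow> f (2 * pi + t) = F t \<and> f (2 * pi - t) = F t"
  by (simp add: f_def cos_add cos_diff arccos_cos)

lemma F_bounds: "0 \<le> F t \<and> F t \<le> E"
  using F_cases[of t] bump_bounds e_le by (metis order.trans)

text \<open>Along \<open>[0, 2 * pi]\<close> the argument \<open>arccos (cos t)\<close> runs through
  \<open>[0, pi]\<close> once up and once down, so the clamped argument has variation at most
  \<open>2 * pi / L k\<close>; the Lipschitz constant \<open>e k * L k\<close> cancels the
  frequency.\<close>

lemma variation_bump:
  assumes k: "1 \<le> k"
    and a: "\<And>j. j < n \<Longrightarrow> 0 \<le> a j \<and> a j \<le> b j \<and> b j \<le> 2 * pi"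
    and b: "\<And>j. Suc j < n \<Longrightarrow> b j \<le> a (Suc j)"
  shows "(\<Sum>j<n. \<bar>bump k (arccos (cos (b j))) - bump k (arccos (cos (a j)))\<bar>) \<le> 2 * pi * e k"
proof -
  \<comment> \<open>Up to an additive constant, the variation on \<open>[0, t]\<close> of the
    clamped argument: the first term grows on \<open>[0, pi]\<close>, the second on
    \<open>[pi, 2 * pi]\<close>.\<close>
  define m where "m t = clamp k (min t pi) - clamp k (2 * pi - max t pi)" for t
  have T: "arccos (cos t) = (if t \<le> pi then t else 2 * pi - t)" if "0 \<le> t" "t \<le> 2 * pi" for t
    using that arccos_cos[of t] arccos_cos[of "2 * pi - t"] by (simp add: cos_diff)
  have m: "\<bar>clamp k (arccos (cos t)) - clamp k (arccos (cos s))\<bar> \<le> m t - m s"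
    if st: "0 \<le> s" "s \<le> t" "t \<le> 2 * pi" for s t
  proof -
    show ?thesis
    proof (cases "t \<le> pi")
      case True
      then show ?thesis using st clamp_mono[of s t k] by (simp add: T m_def)
    next
      case False
      then show ?thesis
        using st clamp_mono[of "2 * pi - t" "2 * pi - s" k] clamp_mono[of s pi k]
          clamp_mono[of "2 * pi - t" pi k]
        by (cases "s \<le> pi") (simp_all add: T m_def)
    qed
  qed
  have eL: "e k * L k \<ge> 0" using e_nonneg[of k] L_pos[OF k] by simp
  have "(\<Sum>j<n. \<bar>bump k (arccos (cos (b j))) - bump k (arccos (cos (a j)))\<bar>)
      \<le> (\<Sum>j<n. e k * L k * (m (b j) - m (a j)))"
    using a by (intro sum_mono order.trans[OF bump_lipschitz] mult_left_mono m eL) auto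
  also have "\<dots> = e k * L k * (\<Sum>j<n. m (b j) - m (a j))" by (simp add: sum_distrib_left)
  also have "\<dots> \<le> e k * L k * (m (2 * pi) - m 0)"
  proof (rule mult_left_mono[OF _ eL], rule sum_chain_mono_le[where m = m and l = 0])
    show "m x \<le> m y" if "0 \<le> x" "x \<le> y" "y \<le> 2 * pi" for x y
      using m[OF that] by linarith
  qed (use a b in auto)
  also have "\<dots> \<le> e k * L k * (2 * (hi k - lo k))"
    using clamp_bounds[OF k, of 0] clamp_bounds[OF k, of pi]
    by (intro mult_left_mono eL) (simp add: m_def)
  also have "\<dots> = 2 * pi * e k" using L_pos[OF k] by (simp add: lo_hi(4)[OF k])
  finally show ?thesis .
qed

text \<open>\<open>S\<close> collects the bumps that are nonzero at some endpoint; each of the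
  \<open>2 * n\<close> endpoints meets at most one. Each increment of \<open>f\<close> is dominated
  by that of a single bump, and for a fixed bump the \<open>p\<close>-th powers add up to at most
  the \<open>p\<close>-th power of its variation.\<close>

lemma variation_f:
  assumes p: "1 \<le> p"
    and a: "\<And>j. j < n \<Longrightarrow> 0 \<le> a j \<and> a j \<le> b j \<and> b j \<le> 2 * pi"
    and b: "\<And>j. Suc j < n \<Longrightarrow> b j \<le> a (Suc j)"
  obtains S :: "nat set" where "finite S" "card S \<le> 2 * n" "0 \<notin> S"
    "(\<Sum>j<n. \<bar>f (b j) - f (a j)\<bar> powr p) \<le> (2 * pi) powr p * (\<Sum>k\<in>S. e k powr p)"
proof -
  define T where "T t = arccos (cos t)" for t :: real
  define X where "X t = {k. bump k (T t) \<noteq> 0}" for t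
  have X: "finite (X t)" "card (X t) \<le> 1" for t
  proof -
    obtain k where "\<And>l. l \<noteq> k \<Longrightarrow> bump l (T t) = 0" using F_cases[of "T t"] by metis
    then have "X t \<subseteq> {k}" by (auto simp: X_def)
    then show "finite (X t)" "card (X t) \<le> 1"
      by (auto simp: finite_subset subset_singleton_iff)
  qed
  define S where "S = (\<Union>j<n. X (a j) \<union> X (b j))"
  have fin: "finite S" using X by (auto simp: S_def)
  have "card S \<le> (\<Sum>j<n. card (X (a j) \<union> X (b j)))"
    unfolding S_def by (intro card_UN_le) simp
  also have "\<dots> \<le> (\<Sum>j<n. 2)"
    using X(2) by (intro sum_mono order.trans[OF card_Un_le]) (metis add_mono one_add_one)
  finally have card: "card S \<le> 2 * n" by simp
  have S0: "0 \<notin> S" by (auto simp: S_def X_def)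
  have diff: "\<bar>f (b j) - f (a j)\<bar> powr p \<le> (\<Sum>k\<in>S. \<bar>bump k (T (b j)) - bump k (T (a j))\<bar> powr p)"
    if j: "j < n" for j
  proof -
    obtain k where k: "f (a j) = bump k (T (a j))" "\<And>i. i \<noteq> k \<Longrightarrow> bump i (T (a j)) = 0"
      unfolding f_def T_def using F_cases[of "arccos (cos (a j))"] by metis
    obtain l where l: "f (b j) = bump l (T (b j))" "\<And>i. i \<noteq> l \<Longrightarrow> bump i (T (b j)) = 0"
      unfolding f_def T_def using F_cases[of "arccos (cos (b j))"] by metis
    have mem: "i \<in> S" if "bump i (T (a j)) \<noteq> 0 \<or> bump i (T (b j)) \<noteq> 0" for i
      using that j by (auto simp: S_def X_def)
    \<comment> \<open>The bump active at the endpoint with the larger value works: at the other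
      endpoint it equals \<open>f\<close> or vanishes, and \<open>f\<close> is nonnegative.\<close>
    have "\<exists>i. \<bar>f (b j) - f (a j)\<bar> \<le> \<bar>bump i (T (b j)) - bump i (T (a j))\<bar>"
    proof (cases "f (a j) \<le> f (b j)")
      case True
      then show ?thesis
        using l(1) k bump_bounds[of k "T (a j)"] bump_bounds[of l "T (a j)"] by (intro exI[of _ l]) (cases "l = k", auto)
    next
      case False
      then show ?thesis
        using k(1) l bump_bounds[of l "T (b j)"] bump_bounds[of k "T (b j)"] by (intro exI[of _ k]) (cases "l = k", auto)
    qed
    then obtain i where i: "\<bar>f (b j) - f (a j)\<bar> \<le> \<bar>bump i (T (b j)) - bump i (T (a j))\<bar>" by blast
    then have i': "\<bar>f (b j) - f (a j)\<bar> powr p \<le> \<bar>bump i (T (b j)) - bump i (T (a j))\<bar> powr p"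
      using p by (intro powr_mono2) auto
    show ?thesis
    proof (cases "i \<in> S")
      case True
      then show ?thesis
        using i' member_le_sum[OF True, of "\<lambda>k. \<bar>bump k (T (b j)) - bump k (T (a j))\<bar> powr p"] fin
        by fastforce
    next
      case False
      then have "bump i (T (a j)) = 0" "bump i (T (b j)) = 0" using mem[of i] by auto
      moreover have "0 \<le> (\<Sum>k\<in>S. \<bar>bump k (T (b j)) - bump k (T (a j))\<bar> powr p)"
        by (intro sum_nonneg) auto
      ultimately show ?thesis using i' by simp
    qed
  qed
  have "(\<Sum>j<n. \<bar>f (b j) - f (a j)\<bar> powr p)
      \<le> (\<Sum>j<n. \<Sum>k\<in>S. \<bar>bump k (T (b j)) - bump k (T (a j))\<bar> powr p)"
    by (intro sum_mono diff) auto
  also have "\<dots> = (\<Sum>k\<in>S. \<Sum>j<n. \<bar>bump k (T (b j)) - bump k (T (a j))\<bar> powr p)"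
    by (rule sum.swap)
  also have "\<dots> \<le> (\<Sum>k\<in>S. (2 * pi * e k) powr p)"
  proof (rule sum_mono)
    fix k assume "k \<in> S"
    then have k: "1 \<le> k" using S0 by (auto intro: Suc_leI gr0I)
    have "(\<Sum>j<n. \<bar>bump k (T (b j)) - bump k (T (a j))\<bar> powr p)
        \<le> (\<Sum>j<n. \<bar>bump k (T (b j)) - bump k (T (a j))\<bar>) powr p"
      by (intro sum_powr_le_powr_sum p) auto
    also have "\<dots> \<le> (2 * pi * e k) powr p"
      using variation_bump[of k n a b] k a b p unfolding T_def by (intro powr_mono2 sum_nonneg) auto
    finally show "(\<Sum>j<n. \<bar>bump k (T (b j)) - bump k (T (a j))\<bar> powr p) \<le> (2 * pi * e k) powr p" .
  qed
  also have "\<dots> = (2 * pi) powr p * (\<Sum>k\<in>S. e k powr p)"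
    using e_nonneg by (simp add: powr_mult sum_distrib_left)
  finally show ?thesis using fin card S0 by (intro that)
qed

text \<open>The point \<open>2 * pi\<close> is \<open>0\<close> modulo the period, lies in the range
  required by \<open>fourier_partial_sum_eq_symmetric\<close>, and \<open>f\<close> is even about
  it.\<close>

lemma fourier_partial_sum_f:
  "fourier_partial_sum f n (2 * pi) = 2 / pi * integral {0..pi} (\<lambda>t. F t * dirichlet n t)"
proof -
  have "fourier_partial_sum f n (2 * pi)
      = (1 / pi) * integral {0..pi} (\<lambda>t. (f (2 * pi + t) + f (2 * pi - t)) * dirichlet n t)"
    by (intro fourier_partial_sum_eq_symmetric f_continuous f_periodic) auto
  also have "integral {0..pi} (\<lambda>t. (f (2 * pi + t) + f (2 * pi - t)) * dirichlet n t)
      = integral {0..pi} (\<lambda>t. 2 * (F t * dirichlet n t))"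
    by (intro integral_cong) (simp add: f_2pi)
  finally show ?thesis by simp
qed

lemma integral_bump:
  assumes k: "1 \<le> k"
  shows "integral {0..pi} (\<lambda>t. bump k t * dirichlet n t)
    = e k * integral {lo k..hi k} (\<lambda>t. sin (L k * t) * dirichlet n t)"
proof -
  have "((\<lambda>t. bump k t * dirichlet n t) has_integral
      integral {lo k..hi k} (\<lambda>t. bump k t * dirichlet n t)) {0..pi}"
  proof (rule has_integral_on_superset)
    show "((\<lambda>t. bump k t * dirichlet n t) has_integral
      integral {lo k..hi k} (\<lambda>t. bump k t * dirichlet n t)) {lo k..hi k}"
      by (intro integrable_integral integrable_continuous_real continuous_intros continuous_bump)
  qed (use lo_hi[OF k] bump_outside[of _ k] in auto)
  then have "integral {0..pi} (\<lambda>t. bump k t * dirichlet n t)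
      = integral {lo k..hi k} (\<lambda>t. bump k t * dirichlet n t)"
    by (rule integral_unique)
  also have "\<dots> = integral {lo k..hi k} (\<lambda>t. e k * (sin (L k * t) * dirichlet n t))"
    by (intro integral_cong) (simp add: bump_inside)
  finally show ?thesis by simp
qed

text \<open>On its own interval the bump has the sign of the kernel.\<close>
lemma integral_bump_resonant:
  assumes k: "1 \<le> k" and L: "L k = real n + 1 / 2"
  shows "e k / (6 * real k) \<le> integral {0..pi} (\<lambda>t. bump k t * dirichlet n t)"
proof -
  let ?L = "L k"
  note J = lo_hi[OF k] and Lp = L_pos[OF k]
  have sq: "((\<lambda>t. (sin (?L * t))\<^sup>2) has_integral
      ((hi k / 2 - sin (2 * (?L * hi k)) / (4 * ?L)) - (lo k / 2 - sin (2 * (?L * lo k)) / (4 * ?L)))) {lo k..hi k}"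
  proof (rule fundamental_theorem_of_calculus)
    fix t
    have "(sin (?L * t))\<^sup>2 = 1 / 2 - cos (2 * (?L * t)) * (2 * ?L) / (4 * ?L)"
      using Lp by (simp add: cos_double_sin diff_divide_distrib)
    then show "((\<lambda>t. t / 2 - sin (2 * (?L * t)) / (4 * ?L)) has_vector_derivative (sin (?L * t))\<^sup>2)
        (at t within {lo k..hi k})"
      using Lp by (auto intro!: derivative_eq_intros
          simp flip: has_real_derivative_iff_has_vector_derivative)
  qed (use J in auto)
  have z: "sin (2 * (?L * hi k)) = 0" "sin (2 * (?L * lo k)) = 0"
    unfolding J(5,6) sin_double by (simp_all only: sin_npi mult_zero_left mult_zero_right)
  \<comment> \<open>In resonance the integrand is the squared sine over
    \<open>2 * sin (t / 2)\<close>, and \<open>2 * sin (t / 2) \<le> t \<le> hi k\<close>. The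
    squared sine has mean \<open>1 / 2\<close> over the half wave, whose length is the fraction
    \<open>1 / (2 * k + 1)\<close> of \<open>hi k\<close>.\<close>
  have "integral {lo k..hi k} (\<lambda>t. (1 / hi k) * (sin (?L * t))\<^sup>2)
      \<le> integral {lo k..hi k} (\<lambda>t. sin (?L * t) * dirichlet n t)"
  proof (rule integral_le)
    fix t assume t: "t \<in> {lo k..hi k}"
    then have t0: "0 < t" "t \<le> pi" using J by auto
    then have s: "sin (t / 2) > 0" by (intro sin_gt_zero) auto
    have "2 * sin (t / 2) \<le> hi k" using sin_x_le_x[of "t / 2"] t t0 by simp
    then have "1 / hi k \<le> 1 / (2 * sin (t / 2))"
      using s by (intro divide_left_mono) auto
    then have "(1 / hi k) * (sin (?L * t))\<^sup>2 \<le> (1 / (2 * sin (t / 2))) * (sin (?L * t))\<^sup>2"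
      by (intro mult_right_mono) auto
    then show "(1 / hi k) * (sin (?L * t))\<^sup>2 \<le> sin (?L * t) * dirichlet n t"
      using dirichlet_eq[OF t0, of n] by (simp add: L power2_eq_square)
  qed (use J in \<open>auto intro!: integrable_continuous_real continuous_intros\<close>)
  also have "integral {lo k..hi k} (\<lambda>t. (1 / hi k) * (sin (?L * t))\<^sup>2) = (1 / hi k) * ((hi k - lo k) / 2)"
    using integral_unique[OF sq] z by (simp add: diff_divide_distrib)
  also have "\<dots> = 1 / (2 * real (2 * k + 1))"
    by (simp only: J(4)) (use Lp in \<open>simp add: hi_def\<close>)
  finally have "1 / (2 * real (2 * k + 1)) \<le> integral {lo k..hi k} (\<lambda>t. sin (?L * t) * dirichlet n t)" .
  moreover have "1 / (6 * real k) \<le> 1 / (2 * real (2 * k + 1))"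
    using k by (intro divide_left_mono) auto
  ultimately show ?thesis
    unfolding integral_bump[OF k] using e_nonneg[of k]
    by (metis (no_types, lifting) mult_left_mono order.trans mult.right_neutral times_divide_eq_right)
qed

text \<open>Integration by parts gains the factor \<open>L k / (n + 1 / 2)\<close>.\<close>
lemma integral_bump_small:
  assumes k: "1 \<le> k"
  shows "\<bar>integral {0..pi} (\<lambda>t. bump k t * dirichlet n t)\<bar> \<le> E * (pi * (L k / (real n + 1 / 2)))"
proof -
  let ?L = "L k"
  define l where "l = real n + 1 / 2"
  note J = lo_hi[OF k] and Lp = L_pos[OF k]
  have l: "l > 0" by (simp add: l_def add_nonneg_pos)
  define w where "w t = 1 / (2 * sin (t / 2))" for t :: real
  \<comment> \<open>\<open>\<psi>\<close> is the derivative of \<open>sin (L k * t) * w t\<close>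
    multiplied by \<open>cos (l * t)\<close>, as left over by the integration by parts; the boundary
    terms vanish with the sine.\<close>
  define \<psi> where "\<psi> t = (?L * cos (?L * t) * w t - sin (?L * t) * (cos (t / 2) * (w t)\<^sup>2)) * cos (l * t)" for t
  have w: "sin (t / 2) > 0" "0 \<le> w t" "w t \<le> ?L / 4" if t: "t \<in> {lo k..hi k}" for t
  proof -
    have t0: "0 < t" "t \<le> pi" using t J by auto
    then show s: "sin (t / 2) > 0" by (intro sin_gt_zero) auto
    then show "0 \<le> w t" by (simp add: w_def)
    \<comment> \<open>As \<open>k \<ge> 1\<close>, the bump starts at \<open>2 * pi / L k\<close> or
      later, which keeps \<open>w\<close> below a multiple of \<open>L k\<close>.\<close>
    have "2 * pi \<le> real (2 * k) * pi" using k by (intro mult_right_mono) auto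
    also have "\<dots> \<le> ?L * t" using t Lp unfolding J(5)[symmetric] by (intro mult_left_mono) auto
    finally have "2 * pi / ?L \<le> t" using Lp by (simp add: pos_divide_le_eq mult.commute)
    then have "2 / ?L \<le> t / pi" using Lp by (simp add: field_simps)
    also have "\<dots> \<le> sin (t / 2)" by (rule sin_half_ge) (use t0 in auto)
    finally have "1 / (2 * sin (t / 2)) \<le> 1 / (2 * (2 / ?L))"
      using s Lp by (intro divide_left_mono mult_left_mono mult_pos_pos) auto
    then show "w t \<le> ?L / 4" by (simp add: w_def)
  qed
  have dw: "(w has_real_derivative - (cos (t / 2) * (w t)\<^sup>2)) (at t within {lo k..hi k})"
    if "t \<in> {lo k..hi k}" for t
    unfolding w_def using w(1)[OF that]
    by (auto intro!: derivative_eq_intros simp: power2_eq_square)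
  then have contw: "continuous_on {lo k..hi k} w"
    by (rule DERIV_continuous_on)
  have cont\<psi>: "continuous_on {lo k..hi k} \<psi>"
    unfolding \<psi>_def by (intro continuous_intros contw) auto
  have "((\<lambda>t. sin (?L * t) * w t * sin (l * t) - \<psi> t / l) has_integral
      (- (sin (?L * hi k) * w (hi k) * cos (l * hi k)) / l - - (sin (?L * lo k) * w (lo k) * cos (l * lo k)) / l))
      {lo k..hi k}"
  proof (rule fundamental_theorem_of_calculus)
    fix t assume t: "t \<in> {lo k..hi k}"
    have "((\<lambda>t. - (sin (?L * t) * w t * cos (l * t)) / l) has_real_derivative
        - ((cos (?L * t) * ?L * w t - sin (?L * t) * (cos (t / 2) * (w t)\<^sup>2)) * cos (l * t)
            - sin (?L * t) * w t * (sin (l * t) * l)) / l) (at t within {lo k..hi k})"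
      using l by (auto intro!: derivative_eq_intros dw[OF t] simp: field_simps)
    moreover have "- ((cos (?L * t) * ?L * w t - sin (?L * t) * (cos (t / 2) * (w t)\<^sup>2)) * cos (l * t)
            - sin (?L * t) * w t * (sin (l * t) * l)) / l
        = sin (?L * t) * w t * sin (l * t) - \<psi> t / l"
      using l by (simp add: \<psi>_def diff_divide_distrib mult_ac)
    ultimately show "((\<lambda>t. - (sin (?L * t) * w t * cos (l * t)) / l) has_vector_derivative
        sin (?L * t) * w t * sin (l * t) - \<psi> t / l) (at t within {lo k..hi k})"
      by (simp add: has_real_derivative_iff_has_vector_derivative)
  qed (use J in auto)
  moreover have "sin (?L * hi k) = 0" "sin (?L * lo k) = 0"
    unfolding J(5,6) by (rule sin_npi)+
  ultimately have 0: "((\<lambda>t. sin (?L * t) * w t * sin (l * t) - \<psi> t / l) has_integral 0) {lo k..hi k}"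
    by simp
  have "integral {lo k..hi k} (\<lambda>t. sin (?L * t) * dirichlet n t)
      = integral {lo k..hi k} (\<lambda>t. (sin (?L * t) * w t * sin (l * t) - \<psi> t / l) + \<psi> t / l)"
  proof (intro integral_cong)
    fix t assume "t \<in> {lo k..hi k}"
    then have "0 < t" "t \<le> pi" using J by auto
    then show "sin (?L * t) * dirichlet n t = (sin (?L * t) * w t * sin (l * t) - \<psi> t / l) + \<psi> t / l"
      using dirichlet_eq[of t n] by (simp add: w_def l_def)
  qed
  also have "\<dots> = 0 + integral {lo k..hi k} (\<lambda>t. \<psi> t / l)"
    using l by (intro integral_unique has_integral_add 0 integrable_integral integrable_continuous_real
        continuous_intros cont\<psi>) auto
  finally have eq: "integral {lo k..hi k} (\<lambda>t. sin (?L * t) * dirichlet n t)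
      = integral {lo k..hi k} (\<lambda>t. \<psi> t / l)" by simp
  have "norm (integral {lo k..hi k} (\<lambda>t. \<psi> t / l)) \<le> (?L\<^sup>2 / l) * (hi k - lo k)"
  proof (rule integral_bound)
    fix t assume t: "t \<in> {lo k..hi k}"
    note wt = w(2,3)[OF t]
    have "\<bar>?L * cos (?L * t) * w t\<bar> \<le> ?L * 1 * (?L / 4)"
      unfolding abs_mult using wt Lp by (intro mult_mono) auto
    moreover have "\<bar>sin (?L * t) * (cos (t / 2) * (w t)\<^sup>2)\<bar> \<le> 1 * (1 * (?L / 4)\<^sup>2)"
      unfolding abs_mult using wt by (intro mult_mono) (auto intro!: power_mono)
    ultimately have "\<bar>?L * cos (?L * t) * w t - sin (?L * t) * (cos (t / 2) * (w t)\<^sup>2)\<bar> \<le> ?L\<^sup>2"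
      using zero_le_square[of ?L] unfolding power2_eq_square by (simp only: mult_1 mult_1_right)
    then have "\<bar>\<psi> t\<bar> \<le> ?L\<^sup>2 * 1"
      unfolding \<psi>_def abs_mult by (intro mult_mono) auto
    then show "norm (\<psi> t / l) \<le> ?L\<^sup>2 / l"
      using l by (simp add: divide_right_mono)
  qed (use J l in \<open>auto intro!: continuous_intros cont\<psi>\<close>)
  also have "\<dots> = pi * (?L / l)"
    unfolding J(4) using Lp by (simp add: power2_eq_square)
  finally have *: "\<bar>integral {lo k..hi k} (\<lambda>t. \<psi> t / l)\<bar> \<le> pi * (?L / l)"
    unfolding real_norm_def .
  have "\<bar>integral {0..pi} (\<lambda>t. bump k t * dirichlet n t)\<bar>
      = e k * \<bar>integral {lo k..hi k} (\<lambda>t. \<psi> t / l)\<bar>"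
    by (simp only: integral_bump[OF k] eq abs_mult abs_of_nonneg[OF e_nonneg])
  also have "\<dots> \<le> e k * (pi * (?L / l))"
    by (intro mult_left_mono * e_nonneg)
  also have "\<dots> \<le> E * (pi * (?L / l))"
    using e_le[of k] Lp l by (intro mult_right_mono) auto
  finally show ?thesis unfolding l_def .
qed

text \<open>The bumps in \<open>A\<close> have small frequency and those in \<open>S\<close> have the frequency of the kernel;
  the remaining ones live so close to \<open>0\<close> that \<open>\<bar>dirichlet n t\<bar> \<le> n + 1 / 2\<close> suffices.\<close>
lemma fourier_partial_sum_f_ge:
  assumes n: "1 \<le> n"
    and fin: "finite A" "finite S" "A \<inter> S = {}" "0 \<notin> A" "0 \<notin> S"
    and S: "\<And>k. k \<in> S \<Longrightarrow> L k = real n + 1 / 2"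
    and A: "(\<Sum>k\<in>A. L k) \<le> real n + 1 / 2"
    and rest: "\<And>k. 1 \<le> k \<Longrightarrow> k \<notin> A \<Longrightarrow> k \<notin> S \<Longrightarrow> hi k \<le> pi / (real n + 1 / 2)"
  shows "(\<Sum>k\<in>S. e k / real k) / (3 * pi) - 4 * E \<le> fourier_partial_sum f n (2 * pi)"
proof -
  let ?l = "real n + 1 / 2"
  \<comment> \<open>The bumps outside \<open>A\<close> and \<open>S\<close>: bounded by
    \<open>E\<close> and supported in \<open>[0, pi / ?l]\<close>, so their integral against the
    kernel is at most \<open>E * pi\<close>.\<close>
  define R where "R t = F t - (\<Sum>k\<in>A \<union> S. bump k t)" for t
  have l: "?l > 0" by (simp add: add_nonneg_pos)
  have contR: "continuous_on U R" for U
    unfolding R_def by (intro continuous_intros continuous_bump continuous_on_subset[OF continuous_F]) auto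
  have R: "0 \<le> R t \<and> R t \<le> E" "t \<notin> {0..pi / ?l} \<Longrightarrow> R t = 0" for t
  proof -
    obtain k where k: "R t = (if k \<in> A \<union> S then 0 else bump k t)"
      unfolding R_def by (rule F_diff_sum[of "A \<union> S" t]) (use fin in auto)
    then show "0 \<le> R t \<and> R t \<le> E"
      using bump_bounds[of k t] e_le[of k] E_nonneg by auto
    assume t: "t \<notin> {0..pi / ?l}"
    show "R t = 0"
    proof (cases "k = 0 \<or> k \<in> A \<union> S")
      case False
      then have "t \<le> lo k \<or> hi k \<le> t" using t rest[of k] lo_hi(1)[of k] by auto
      then show ?thesis using k bump_outside by auto
    qed (use k in auto)
  qed
  have bI: "(\<lambda>t. bump k t * dirichlet n t) integrable_on {0..pi}" for k
    by (intro integrable_continuous_real continuous_intros continuous_bump)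
  have "norm (integral {0..pi / ?l} (\<lambda>t. R t * dirichlet n t)) \<le> (E * ?l) * (pi / ?l - 0)"
  proof (rule integral_bound)
    show "norm (R t * dirichlet n t) \<le> E * ?l" for t
      unfolding real_norm_def abs_mult using R(1)[of t] abs_dirichlet_le[of n t] by (intro mult_mono) auto
  qed (use l in \<open>auto intro!: continuous_intros contR\<close>)
  also have "(E * ?l) * (pi / ?l - 0) = E * pi" using l by simp
  finally have I1: "\<bar>integral {0..pi / ?l} (\<lambda>t. R t * dirichlet n t)\<bar> \<le> E * pi" by simp
  have "pi / ?l \<le> pi / 1" using n by (intro divide_left_mono) auto
  then have "((\<lambda>t. R t * dirichlet n t) has_integral integral {0..pi / ?l} (\<lambda>t. R t * dirichlet n t)) {0..pi}"
    using R(2) by (intro has_integral_on_superset[where S = "{0..pi / ?l}" and T = "{0..pi}"]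
        integrable_integral integrable_continuous_real continuous_intros contR) auto
  then have IR: "integral {0..pi} (\<lambda>t. R t * dirichlet n t) = integral {0..pi / ?l} (\<lambda>t. R t * dirichlet n t)"
    by (rule integral_unique)
  let ?I = "\<lambda>k. integral {0..pi} (\<lambda>t. bump k t * dirichlet n t)"
  have "integral {0..pi} (\<lambda>t. F t * dirichlet n t)
      = integral {0..pi} (\<lambda>t. (\<Sum>k\<in>A \<union> S. bump k t * dirichlet n t) + R t * dirichlet n t)"
    by (intro integral_cong) (simp add: R_def left_diff_distrib sum_distrib_right)
  also have "\<dots> = integral {0..pi} (\<lambda>t. \<Sum>k\<in>A \<union> S. bump k t * dirichlet n t)
      + integral {0..pi} (\<lambda>t. R t * dirichlet n t)"
    using fin by (intro integral_add integrable_sum bI integrable_continuous_real continuous_intros contR) auto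
  also have "integral {0..pi} (\<lambda>t. \<Sum>k\<in>A \<union> S. bump k t * dirichlet n t) = (\<Sum>k\<in>A \<union> S. ?I k)"
    using fin by (intro integral_sum bI) auto
  also have "\<dots> = (\<Sum>k\<in>A. ?I k) + (\<Sum>k\<in>S. ?I k)"
    using fin by (intro sum.union_disjoint) auto
  finally have split: "integral {0..pi} (\<lambda>t. F t * dirichlet n t)
      = (\<Sum>k\<in>A. ?I k) + (\<Sum>k\<in>S. ?I k) + integral {0..pi / ?l} (\<lambda>t. R t * dirichlet n t)"
    unfolding IR .
  have pos: "1 \<le> k" if "k \<in> A \<union> S" for k
    using that fin by (cases k) auto
  have "\<bar>\<Sum>k\<in>A. ?I k\<bar> \<le> (\<Sum>k\<in>A. E * (pi * (L k / ?l)))"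
    using pos by (intro order.trans[OF sum_abs] sum_mono integral_bump_small) auto
  also have "\<dots> = E * pi * ((\<Sum>k\<in>A. L k) / ?l)"
    by (simp add: sum_distrib_left sum_divide_distrib mult.assoc)
  also have "\<dots> \<le> E * pi * 1"
    using A l E_nonneg by (intro mult_left_mono) (auto simp: pos_divide_le_eq)
  finally have IA: "\<bar>\<Sum>k\<in>A. ?I k\<bar> \<le> E * pi" by simp
  have IS: "(\<Sum>k\<in>S. e k / (6 * real k)) \<le> (\<Sum>k\<in>S. ?I k)"
    using pos S by (intro sum_mono integral_bump_resonant) auto
  \<comment> \<open>\<open>A\<close> and \<open>R\<close> cost at most \<open>E * pi\<close> each;
    the prefactor \<open>2 / pi\<close> turns this into \<open>4 * E\<close> and the
    \<open>1 / 6\<close> into \<open>1 / (3 * pi)\<close>.\<close>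
  have "(\<Sum>k\<in>S. e k / real k) / 6 - 2 * (E * pi) \<le> integral {0..pi} (\<lambda>t. F t * dirichlet n t)"
    unfolding split using IA IS I1 by (simp add: sum_divide_distrib mult.commute)
  then have "2 / pi * ((\<Sum>k\<in>S. e k / real k) / 6 - 2 * (E * pi))
      \<le> 2 / pi * integral {0..pi} (\<lambda>t. F t * dirichlet n t)"
    by (intro mult_left_mono) auto
  then show ?thesis
    unfolding fourier_partial_sum_f by (simp add: field_simps)
qed

end

section \<open>Choice of the stages and failure of convergence\<close>

text \<open>Partial sums of a divergent nonnegative series are unbounded, so after any index a
  finite block has a sum as large as desired; the stages are chosen recursively.\<close>

lemma diverging_stages:
  fixes a :: "nat \<Rightarrow> real"
  assumes a: "\<And>k. 0 \<le> a k" and div: "\<not> summable a"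
  obtains M :: "nat \<Rightarrow> nat" where "M 0 = 0" "\<And>i. M i < M (Suc i)"
    "\<And>i. real i \<le> (\<Sum>k\<in>{M i<..M (Suc i)}. a k)"
proof -
  have "\<exists>n>m. real i \<le> (\<Sum>k\<in>{m<..n}. a k)" for m i
  proof -
    have "\<exists>n. (\<Sum>k<n. a k) > (\<Sum>k\<le>m. a k) + real i"
    proof (rule ccontr)
      assume "\<not> ?thesis"
      then have "summable a"
        by (intro summableI_nonneg_bounded[where x = "(\<Sum>k\<le>m. a k) + real i"] a) (auto simp: not_less)
      with div show False by simp
    qed
    then obtain n where n: "(\<Sum>k<n. a k) > (\<Sum>k\<le>m. a k) + real i" by blast
    have "m < n"
    proof (rule ccontr)
      assume "\<not> m < n"
      then have "(\<Sum>k<n. a k) \<le> (\<Sum>k\<le>m. a k)" using a by (intro sum_mono2) auto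
      with n show False by simp
    qed
    have "(\<Sum>k<n. a k) \<le> (\<Sum>k\<in>{..m} \<union> {m<..n}. a k)" using a by (intro sum_mono2) auto
    also have "\<dots> = (\<Sum>k\<le>m. a k) + (\<Sum>k\<in>{m<..n}. a k)" by (intro sum.union_disjoint) auto
    finally show ?thesis using n \<open>m < n\<close> by (intro exI[of _ n]) auto
  qed
  then obtain g where g: "\<And>m i. m < g m i" "\<And>m i. real i \<le> (\<Sum>k\<in>{m<..g m i}. a k)"
    by metis
  define M where "M = rec_nat 0 (\<lambda>i m. g m i)"
  have "M (Suc i) = g (M i) i" for i by (simp add: M_def)
  then show ?thesis using g by (intro that[of M]) (auto simp: M_def)
qed

context modulus
begin

lemma ex_diverging_fourier_series:
  assumes div: "\<not> summable (\<lambda>k. eps_p p \<nu> (Suc k) / real (Suc k))"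
  shows "\<exists>f \<in> Vp p \<nu>. continuous_on UNIV f \<and>
    \<not> uniform_limit UNIV (fourier_partial_sum f) f sequentially"
proof -
  define e where "e = eps_p p \<nu>"
  have "\<not> summable (\<lambda>k. e k / real k)"
    using div unfolding e_def by (subst (asm) summable_Suc_iff[where f = "\<lambda>k. eps_p p \<nu> k / real k"])
  then obtain M where M: "M 0 = 0" "\<And>i. M i < M (Suc i)"
    "\<And>i. real i \<le> (\<Sum>k\<in>{M i<..M (Suc i)}. e k / real k)"
    by (rule diverging_stages[rotated]) (auto simp: e_def)
  \<comment> \<open>The factor \<open>2 * M (Suc (Suc i)) + 1\<close> bounds
    \<open>2 * k + 1\<close> for every \<open>k\<close> in stage \<open>Suc i\<close>. The resulting
    growth \<open>l_step\<close> separates different stages and makes all earlier frequencies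
    together at most the current one.\<close>
  define N where "N = rec_nat (2 * M 1 + 1) (\<lambda>i n. (2 * M (Suc (Suc i)) + 1) * (n + 1))"
  have N: "N 0 = 2 * M 1 + 1" "\<And>i. N (Suc i) = (2 * M (Suc (Suc i)) + 1) * (N i + 1)"
    by (simp_all add: N_def)
  define l where "l i = real (N i) + 1 / 2" for i
  have l_pos: "0 < l i" for i by (simp add: l_def add_nonneg_pos)
  have l_step: "real (2 * M (Suc (Suc i)) + 1) * l i \<le> l (Suc i)" for i
    unfolding l_def N(2) of_nat_mult by (simp add: distrib_left)
  have l_ge: "real (2 * M (Suc i) + 1) \<le> l i" for i
  proof (cases i)
    case 0
    then show ?thesis by (simp add: l_def N(1))
  next
    case (Suc j)
    have "real (2 * M (Suc (Suc j)) + 1) * 1 \<le> real (2 * M (Suc (Suc j)) + 1) * real (N j + 1)"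
      by (intro mult_left_mono) auto
    then show ?thesis unfolding Suc l_def N(2) of_nat_mult mult_1_right by linarith
  qed
  have l_mono: "l i \<le> l j" if "i \<le> j" for i j
  proof (rule lift_Suc_mono_le[OF _ that])
    fix i
    have "1 * l i \<le> real (2 * M (Suc (Suc i)) + 1) * l i"
      using l_pos[of i] by (intro mult_right_mono) auto
    then show "l i \<le> l (Suc i)" using l_step[of i] by simp
  qed
  have M_mono: "M i \<le> M j" if "i \<le> j" for i j
    by (rule lift_Suc_mono_le[OF _ that]) (use M(2) less_imp_le in blast)
  have M_ge: "i \<le> M i" for i
  proof (induction i)
    case (Suc i)
    then show ?case using M(2)[of i] by linarith
  qed simp
  have N_ge: "i \<le> N i" for i
  proof (induction i)
    case (Suc i)
    have "1 * (N i + 1) \<le> N (Suc i)" unfolding N(2) by (intro mult_right_mono) auto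
    with Suc show ?case by simp
  qed simp

  \<comment> \<open>The stage of \<open>k\<close>: for \<open>k \<ge> 1\<close> the unique
    \<open>i\<close> with \<open>M i < k \<le> M (Suc i)\<close>.\<close>
  define q where "q k = (LEAST i. k \<le> M (Suc i))" for k
  have q_le: "k \<le> M (Suc (q k))" for k
    unfolding q_def by (rule LeastI[of _ k]) (use M_ge[of "Suc k"] in linarith)
  have q_gt: "M (q k) < k" if "1 \<le> k" for k
  proof (cases "q k")
    case 0
    then show ?thesis using M(1) that by simp
  next
    case (Suc j)
    have "\<not> k \<le> M (Suc j)"
      using not_less_Least[of j "\<lambda>i. k \<le> M (Suc i)"] Suc unfolding q_def by simp
    then show ?thesis using Suc by simp
  qed
  have q_eq: "q k = i" if "k \<in> {M i<..M (Suc i)}" for k i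
  proof -
    have "q k \<le> i" unfolding q_def by (rule Least_le) (use that in auto)
    moreover have "\<not> q k < i"
    proof
      assume "q k < i"
      then have "k \<le> M i" using q_le[of k] M_mono[of "Suc (q k)" i] by simp
      then show False using that by simp
    qed
    ultimately show ?thesis by simp
  qed
  define L where "L k = l (q k)" for k
  \<comment> \<open>Bumps of stages after \<open>i\<close> lie in \<open>[0, pi / l i]\<close>, to
    the left of all bumps of stage \<open>i\<close>, which start at \<open>2 * pi / l i\<close> or
    later.\<close>
  have hi_le: "real (2 * k + 1) * pi / L k \<le> pi / l i" if iq: "i < q k" for k i
  proof -
    obtain j where j: "q k = Suc j" "i \<le> j" using iq by (cases "q k") auto
    have "real (2 * k + 1) * l i \<le> real (2 * M (Suc (Suc j)) + 1) * l j"
      using q_le[of k] j l_mono[OF j(2)] l_pos[of i] by (intro mult_mono) auto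
    also have "\<dots> \<le> L k" using l_step[of j] by (simp add: L_def j)
    finally have "real (2 * k + 1) * l i * pi \<le> L k * pi" by (intro mult_right_mono) auto
    then show ?thesis
      using l_pos[of i] l_pos[of "q k"] by (simp add: L_def field_simps)
  qed
  \<comment> \<open>Later stages lie further left; within one stage the frequency is common and
    larger indices lie further right.\<close>
  have disj: "real (2 * k + 1) * pi / L k \<le> real (2 * m) * pi / L m"
    if "1 \<le> m" "q m < q k \<or> (q m = q k \<and> k < m)" for k m
    using that(2)
  proof (elim disjE conjE)
    assume "q m < q k"
    then have "real (2 * k + 1) * pi / L k \<le> pi / L m" unfolding L_def[of m] by (rule hi_le)
    also have "\<dots> \<le> real (2 * m) * pi / L m"
      using that(1) l_pos[of "q m"] by (intro divide_right_mono) (auto simp: L_def)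
    finally show ?thesis .
  next
    assume "q m = q k" "k < m"
    then show ?thesis
      using l_pos[of "q m"] by (auto simp: L_def intro!: divide_right_mono mult_right_mono)
  qed
  interpret bumps e L "\<nu> 1"
  proof
    show "e 0 = 0" by (simp add: e_def eps_p_def)
    show "0 \<le> e k" "e k \<le> \<nu> 1" for k
      unfolding e_def by (rule eps_p_nonneg eps_p_le_nu_1)+
    show "e \<longlonglongrightarrow> 0" unfolding e_def by (rule eps_p_tendsto_0)
    show "real (2 * k + 1) \<le> L k" if "1 \<le> k" for k
      using q_le[of k] l_ge[of "q k"] by (simp add: L_def)
    show "real (2 * k + 1) * pi / L k \<le> real (2 * m) * pi / L m \<or>
       real (2 * m + 1) * pi / L m \<le> real (2 * k) * pi / L k"
      if "1 \<le> k" "1 \<le> m" "k \<noteq> m" for k m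
      using disj[of m k] disj[of k m] that by (metis linorder_neqE_nat)
  qed

  have "f \<in> Vp p \<nu>"
    unfolding Vp_def
  proof (intro CollectI conjI exI allI impI)
    have "\<bar>f t\<bar> \<le> \<nu> 1" for t using F_bounds[of "arccos (cos t)"] by (simp add: f_def)
    then show "bounded (range f)" unfolding bounded_iff by auto
    show "periodic_2pi f" by (rule f_periodic)
    fix n :: nat assume n: "n \<ge> 1"
    \<comment> \<open>In \<open>8 * pi\<close> the factor \<open>2 * pi\<close> is the variation of
      one bump. The factor \<open>4\<close> comes from \<open>sum_eps_p_le\<close> with
      \<open>2 * n\<close> indices and \<open>nu_double_powr\<close>, absorbed into the power by
      \<open>4 \<le> 4 powr p\<close>.\<close>
    show "upsilon_p p n f \<le> 8 * pi * \<nu> n"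
      unfolding upsilon_p_def
    proof (rule cSup_least)
      have "(\<Sum>j<n. \<bar>f 0 - f 0\<bar> powr p) powr (1 / p) \<in> var_sums p n f"
        unfolding var_sums_def by (intro CollectI exI[of _ "\<lambda>_. 0"]) auto
      then show "var_sums p n f \<noteq> {}" by blast
      fix v assume "v \<in> var_sums p n f"
      then obtain a b where v: "v = (\<Sum>j<n. \<bar>f (b j) - f (a j)\<bar> powr p) powr (1 / p)"
        and ab: "\<And>j. j < n \<Longrightarrow> 0 \<le> a j \<and> a j \<le> b j \<and> b j \<le> 2 * pi"
          "\<And>j. Suc j < n \<Longrightarrow> b j \<le> a (Suc j)"
        unfolding var_sums_def by blast
      obtain S where S: "finite S" "card S \<le> 2 * n" "0 \<notin> S"
        "(\<Sum>j<n. \<bar>f (b j) - f (a j)\<bar> powr p) \<le> (2 * pi) powr p * (\<Sum>k\<in>S. e k powr p)"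
        by (rule variation_f[of p n a b]) (use p ab in auto)
      have "(\<Sum>k\<in>S. e k powr p) \<le> 2 * \<nu> (2 * n) powr p"
        unfolding e_def by (rule sum_eps_p_le) (use S in auto)
      also have "\<dots> \<le> 2 * (2 * \<nu> n powr p)"
        by (intro mult_left_mono nu_double_powr) auto
      also have "\<dots> = 4 powr 1 * \<nu> n powr p" by simp
      also have "\<dots> \<le> 4 powr p * \<nu> n powr p"
        using p by (intro mult_right_mono powr_mono) auto
      finally have "(2 * pi) powr p * (\<Sum>k\<in>S. e k powr p) \<le> (2 * pi) powr p * (4 powr p * \<nu> n powr p)"
        by (intro mult_left_mono) auto
      also have "\<dots> = (8 * pi * \<nu> n) powr p"
        by (simp add: mult.assoc flip: powr_mult)
      finally have "(\<Sum>j<n. \<bar>f (b j) - f (a j)\<bar> powr p) \<le> (8 * pi * \<nu> n) powr p"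
        using S(4) by linarith
      then have "v \<le> ((8 * pi * \<nu> n) powr p) powr (1 / p)"
        unfolding v using p by (intro powr_mono2[of "1 / p"]) (auto intro: sum_nonneg)
      also have "\<dots> = 8 * pi * \<nu> n" using p by (simp add: powr_powr)
      finally show "v \<le> 8 * pi * \<nu> n" .
    qed
  qed

  moreover have "\<not> uniform_limit UNIV (fourier_partial_sum f) f sequentially"
  proof
    assume "uniform_limit UNIV (fourier_partial_sum f) f sequentially"
    then have "(\<lambda>n. fourier_partial_sum f n (2 * pi)) \<longlonglongrightarrow> f (2 * pi)"
      by (rule tendsto_uniform_limitI) simp
    then have "Bseq (\<lambda>n. fourier_partial_sum f n (2 * pi))"
      by (rule convergent_imp_Bseq[OF convergentI])
    then obtain K where K: "\<And>n. \<bar>fourier_partial_sum f n (2 * pi)\<bar> \<le> K"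
      by (auto simp: Bseq_def)
    \<comment> \<open>The kernel of order \<open>N i\<close> resonates with exactly stage
      \<open>i\<close>: the indices up to \<open>M i\<close> have low frequency, and those beyond
      \<open>M (Suc i)\<close> sit near \<open>0\<close>.\<close>
    have "real i / (3 * pi) - 4 * \<nu> 1 \<le> K" for i
    proof -
      have "(\<Sum>k\<in>{M i<..M (Suc i)}. e k / real k) / (3 * pi) - 4 * \<nu> 1
          \<le> fourier_partial_sum f (N i) (2 * pi)"
      proof (rule fourier_partial_sum_f_ge[where A = "{1..M i}"])
        show "1 \<le> N i" by (cases i) (simp_all add: N)
        show "L k = real (N i) + 1 / 2" if "k \<in> {M i<..M (Suc i)}" for k
          using q_eq[OF that] by (simp add: L_def l_def)
        show "(\<Sum>k\<in>{1..M i}. L k) \<le> real (N i) + 1 / 2"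
        proof (cases i)
          case 0
          then show ?thesis using M(1) by simp
        next
          \<comment> \<open>There are \<open>M i\<close> earlier bumps, each of frequency at most
            \<open>l j\<close>, and one step of the recursion outgrows their total.\<close>
          case (Suc j)
          have "(\<Sum>k\<in>{1..M i}. L k) \<le> (\<Sum>k\<in>{1..M i}. l j)"
          proof (rule sum_mono)
            fix k assume k: "k \<in> {1..M i}"
            have "q k \<le> j" unfolding q_def by (rule Least_le) (use k Suc in auto)
            then show "L k \<le> l j" unfolding L_def by (rule l_mono)
          qed
          also have "\<dots> = real (M (Suc j)) * l j" by (simp add: Suc)
          also have "\<dots> \<le> real (2 * M (Suc (Suc j)) + 1) * l j"
            using M(2)[of "Suc j"] l_pos[of j] by (intro mult_right_mono) auto
          also have "\<dots> \<le> l i" unfolding Suc by (rule l_step)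
          finally show ?thesis by (simp add: l_def)
        qed
        show "hi k \<le> pi / (real (N i) + 1 / 2)" if k: "1 \<le> k" "k \<notin> {1..M i}" "k \<notin> {M i<..M (Suc i)}" for k
        proof -
          have "M (Suc i) < k" using k by auto
          then have "i < q k" using q_le[of k] M_mono[of "Suc (q k)" "Suc i"] by (force simp: not_less)
          then show ?thesis using hi_le unfolding hi_def l_def by blast
        qed
      qed auto
      moreover have "real i / (3 * pi) \<le> (\<Sum>k\<in>{M i<..M (Suc i)}. e k / real k) / (3 * pi)"
        by (intro divide_right_mono M(3)) auto
      ultimately show ?thesis using K[of "N i"] by linarith
    qed
    then have "real i \<le> (K + 4 * \<nu> 1) * (3 * pi)" for i
      by (simp only: pos_divide_le_eq[symmetric] diff_le_eq zero_less_mult_iff pi_gt_zero zero_less_numeral simp_thms)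
    then show False by (meson reals_Archimedean2 not_le)
  qed
  ultimately show ?thesis using f_continuous by blast
qed

end

theorem theorem7p5:
  fixes p :: real and \<nu> :: "nat \<Rightarrow> real"
  assumes p: "1 \<le> p"
    and mv: "modulus_of_variation \<nu>"
    and nu_inf: "filterlim \<nu> at_top sequentially"
    and decr: "\<forall>k\<ge>1. \<nu> (Suc k) / real (Suc k) powr (1 / p) \<le> \<nu> k / real k powr (1 / p)"
    and lim0: "(\<lambda>k. \<nu> k / real k powr (1 / p)) \<longlonglongrightarrow> 0"
  defines "I \<equiv> (\<forall>f \<in> Vp p \<nu>. continuous_on UNIV f \<longrightarrow>
                   uniform_limit UNIV (fourier_partial_sum f) f sequentially)"
    and "II \<equiv> summable (\<lambda>k. \<nu> (Suc k) * real (Suc k) powr (-(1 + 1 / p)))"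
    and "III \<equiv> summable (\<lambda>k. Delta (\<lambda>j. real j powr (-(1 / p))) (Suc k) * \<nu> (Suc k))"
    and "IV \<equiv> summable (\<lambda>k. eps_p 1 \<nu> (Suc k) * real (Suc k) powr (-(1 / p)))"
    and "V \<equiv> summable (\<lambda>k. eps_p p \<nu> (Suc k) / real (Suc k))"
  shows "(I \<longleftrightarrow> II) \<and> (II \<longleftrightarrow> III) \<and> (III \<longleftrightarrow> IV) \<and> (IV \<longleftrightarrow> V)"
proof -
  interpret modulus p \<nu>
    by unfold_locales fact+
  \<comment> \<open>The implications close up as II to V to IV to III to II, together with II to I
    and I to V.\<close>
  have "II \<longleftrightarrow> III" unfolding II_def III_def by (rule summable_II_iff_III)
  moreover have "III \<longleftrightarrow> IV" unfolding III_def IV_def by (rule summable_III_iff_IV)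
  moreover have "II \<Longrightarrow> V" unfolding II_def V_def by (rule summable_II_imp_V)
  moreover have "V \<Longrightarrow> IV" unfolding V_def IV_def by (rule summable_V_imp_IV)
  moreover have "II \<Longrightarrow> I" unfolding I_def II_def using Vp_fourier_uniform_limit by blast
  moreover have "I \<Longrightarrow> V" unfolding I_def V_def using ex_diverging_fourier_series by blast
  ultimately show ?thesis by blast
qed

end
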